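(* Let $G$ be a finite connected graph, and let $X=X(G)$ be the metric graph obtained from $G$ by making each edge isometric to the real interval $[0,1]$ (with the induced intrinsic metric on $X$). Let $c(G)$ be the cop number of the graph $G$, and let $c(X)$ and $c_0(X)$ be the cop number and the strong cop number of the geodesic space $X$. Then $$c(G) \le c(X) \le c_0(X) \le c(G)+1 .$$
   Context: **Discrete game.** The cop number $c(G)$ of a finite connected graph $G$ is the minimum number $k$ of cops that can guarantee to capture a robber in the classical game of Cops and Robber on $G$: the cops choose starting vertices, then the robber chooses a starting vertex; then the cops and the robber alternately move, each player moving to an adjacent vertex or staying in place; all positions are visible; the cops win if some cop occupies the same vertex as the robber. **Game on a geodesic space.** Let $(X,d)$ be a compact path-connected geodesic space (every two points $x,y$ are joined by a path of length $d(x,y)$) and let $k\ge 1$. The player controlling the robber selects the initial positions $(r^0,c_1^0,\dots,c_k^0)\in X^{k+1}$ of the robber and of the $k$ cops, and an agility function $\tau:\mathbb N\to\mathbb R_+$ with $\sum_{n\ge1}\tau(n)=\infty$. In step $n\ge1$ the robber moves to a point $r^n$ with $d(r^{n-1},r^n)\le\tau(n)$; this is revealed to the cops; then each cop $i$ moves to a point $c_i^n$ with $d(c_i^{n-1},c_i^n)\le\tau(n)$. If $c_i^n=r^n$ for some $i$, the game stops, the cops have caught the robber, and the value of the game is $0$. If the game never stops, its value is $v=\inf_{n\ge0}\min_{i} d(r^n,c_i^n)$. A strategy of the robber is a function $s:X\times X^k\times\mathbb R_+\to X$, $(r,c,t)\mapsto r'$ with $d(r,r')\le t$ (the choice of the initial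 position is regarded as part of $s$); a strategy of the cops is a function $q:(r',c,t)\mapsto c'\in X^k$ with $d(c_i,c_i')\le t$ for all $i$. Strategies may depend on the agility $\tau$, which is known to both players. Let $v_\tau(s,q)$ be the value of the game played with agility $\tau$ and strategies $s,q$. Put $\underline{\mathrm{Val}}_C=\sup_\tau\sup_s\inf_q v_\tau(s,q)$ and $\overline{\mathrm{Val}}_R=\sup_\tau\inf_q\sup_s v_\tau(s,q)$; it is known that these are equal. The cops win if $\underline{\mathrm{Val}}_C=0$ (they need not catch the robber); the robber wins if $\overline{\mathrm{Val}}_R>0$. The cop number $c(X)$ is the minimum $k$ such that $k$ cops win the game on $X$ ($\infty$ if there is no such $k$). The strong cop number $c_0(X)$ is the minimum $k$ such that $k$ cops can always catch the robber, i.e. whatever the robber does they can achieve $c_i^n=r^n$ for some $i$ and $n$. *)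

theory Defs
  imports
    "Graph_Theory.Graph_Theory"
    "HOL-Library.FuncSet"
    "HOL-Library.Extended_Nat"
    "HOL-Library.Extended_Real"
    Complex_Main
begin

section \<open>Cops and Robber on a graph\<close>

text \<open>
  A finite simple graph is a \<^term>\<open>pair_graph\<close>: finite, symmetric, loop-free.
  Positions of \<open>k\<close> players are extensional functions on \<open>{..<k}\<close>, that is, honest \<open>k\<close>-tuples.
\<close>

definition tuples :: "'p set \<Rightarrow> nat \<Rightarrow> (nat \<Rightarrow> 'p) set" where
  "tuples X k = {..<k} \<rightarrow>\<^sub>E X"

definition graph_move :: "'a pair_pre_digraph \<Rightarrow> 'a \<Rightarrow> 'a \<Rightarrow> bool" where
  "graph_move G u v \<longleftrightarrow> u \<in> pverts G \<and> v \<in> pverts G \<and> (u = v \<or> (u, v) \<in> parcs G)"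

text \<open>
  A strategy \<open>q\<close> of the cops maps the finite sequence of robber positions seen so far to the
  next cop positions (the earlier cop positions are determined by that sequence). The order of
  events is \<open>q []\<close>, \<open>r 0\<close>, \<open>q [r 0]\<close>, \<open>r 1\<close>, \<open>q [r 0, r 1]\<close>, and so on. Capture occurs either
  when the robber moves onto a cop or when a cop moves onto the robber; what the players do
  afterwards is irrelevant.
\<close>

definition graph_cops_win :: "'a pair_pre_digraph \<Rightarrow> nat \<Rightarrow> bool" where
  "graph_cops_win G k \<longleftrightarrow>
    (\<exists>q :: 'a list \<Rightarrow> nat \<Rightarrow> 'a.
      (\<forall>h. set h \<subseteq> pverts G \<longrightarrow> q h \<in> tuples (pverts G) k) \<and>
      (\<forall>r :: nat \<Rightarrow> 'a. (\<forall>n. graph_move G (r n) (r (Suc n))) \<longrightarrow>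
        (let c = (\<lambda>n. q (map r [0..<n])) in
          (\<forall>n. \<forall>i<k. graph_move G (c n i) (c (Suc n) i)) \<and>
          (\<exists>n. \<exists>i<k. c n i = r n \<or> c (Suc n) i = r n))))"

definition graph_cop_number :: "'a pair_pre_digraph \<Rightarrow> enat" where
  "graph_cop_number G = Inf {enat k | k. graph_cops_win G k}"

section \<open>Cops and Robber on a geodesic space\<close>

text \<open>The space is given by its carrier \<open>X\<close> and its distance function \<open>d\<close>.\<close>

definition agilities :: "(nat \<Rightarrow> real) set" where
  "agilities = {\<tau>. (\<forall>n\<ge>1. 0 \<le> \<tau> n) \<and>
     filterlim (\<lambda>N. \<Sum>n=1..N. \<tau> n) at_top sequentially}"

definition robber_strategies ::
  "'p set \<Rightarrow> ('p \<Rightarrow> 'p \<Rightarrow> real) \<Rightarrow> nat \<Rightarrow> ('p \<Rightarrow> (nat \<Rightarrow> 'p) \<Rightarrow> real \<Rightarrow> 'p) set" where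
  "robber_strategies X d k =
    {s. \<forall>r\<in>X. \<forall>c\<in>tuples X k. \<forall>t\<ge>0. s r c t \<in> X \<and> d r (s r c t) \<le> t}"

definition cop_strategies ::
  "'p set \<Rightarrow> ('p \<Rightarrow> 'p \<Rightarrow> real) \<Rightarrow> nat \<Rightarrow> ('p \<Rightarrow> (nat \<Rightarrow> 'p) \<Rightarrow> real \<Rightarrow> nat \<Rightarrow> 'p) set" where
  "cop_strategies X d k =
    {q. \<forall>r\<in>X. \<forall>c\<in>tuples X k. \<forall>t\<ge>0.
      q r c t \<in> tuples X k \<and> (\<forall>i<k. d (c i) (q r c t i) \<le> t)}"

primrec play ::
  "(nat \<Rightarrow> real) \<Rightarrow> 'p \<times> (nat \<Rightarrow> 'p) \<Rightarrow> ('p \<Rightarrow> (nat \<Rightarrow> 'p) \<Rightarrow> real \<Rightarrow> 'p) \<Rightarrow>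
   ('p \<Rightarrow> (nat \<Rightarrow> 'p) \<Rightarrow> real \<Rightarrow> nat \<Rightarrow> 'p) \<Rightarrow> nat \<Rightarrow> 'p \<times> (nat \<Rightarrow> 'p)" where
  "play \<tau> p0 s q 0 = p0"
| "play \<tau> p0 s q (Suc n) =
    (let (r, c) = play \<tau> p0 s q n; r' = s r c (\<tau> (Suc n)) in (r', q r' c (\<tau> (Suc n))))"

definition game_value ::
  "('p \<Rightarrow> 'p \<Rightarrow> real) \<Rightarrow> nat \<Rightarrow> (nat \<Rightarrow> 'p \<times> (nat \<Rightarrow> 'p)) \<Rightarrow> ereal" where
  "game_value d k P =
    (if \<exists>n. \<exists>i<k. snd (P n) i = fst (P n) then 0
     else (INF n. ereal (Min ((\<lambda>i. d (fst (P n)) (snd (P n) i)) ` {..<k}))))"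

text \<open>
  The choice of the initial positions \<open>p0\<close> (of all players) belongs to the robber's strategy.
\<close>

definition val_C :: "'p set \<Rightarrow> ('p \<Rightarrow> 'p \<Rightarrow> real) \<Rightarrow> nat \<Rightarrow> ereal" where
  "val_C X d k =
    (SUP \<tau>\<in>agilities. SUP (p0, s)\<in>(X \<times> tuples X k) \<times> robber_strategies X d k.
      INF q\<in>cop_strategies X d k. game_value d k (play \<tau> p0 s q))"

definition cop_number :: "'p set \<Rightarrow> ('p \<Rightarrow> 'p \<Rightarrow> real) \<Rightarrow> enat" where
  "cop_number X d = Inf {enat k | k. k \<ge> 1 \<and> val_C X d k = 0}"

text \<open>
  For the strong version the cops need a strategy that leads to capture against every admissible
  sequence of robber moves.
\<close>

definition cops_catch :: "'p set \<Rightarrow> ('p \<Rightarrow> 'p \<Rightarrow> real) \<Rightarrow> nat \<Rightarrow> bool" where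
  "cops_catch X d k \<longleftrightarrow>
    (\<forall>\<tau>\<in>agilities. \<exists>q\<in>cop_strategies X d k.
      \<forall>(r :: nat \<Rightarrow> 'p) (c :: nat \<Rightarrow> nat \<Rightarrow> 'p).
        (\<forall>n. r n \<in> X) \<and> c 0 \<in> tuples X k \<and>
        (\<forall>n. d (r n) (r (Suc n)) \<le> \<tau> (Suc n)) \<and>
        (\<forall>n. c (Suc n) = q (r (Suc n)) (c n) (\<tau> (Suc n))) \<longrightarrow>
        (\<exists>n. \<exists>i<k. c n i = r n))"

definition strong_cop_number :: "'p set \<Rightarrow> ('p \<Rightarrow> 'p \<Rightarrow> real) \<Rightarrow> enat" where
  "strong_cop_number X d = Inf {enat k | k. k \<ge> 1 \<and> cops_catch X d k}"

section \<open>The metric graph of a graph\<close>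

text \<open>
  Points are written in barycentric coordinates, so that the two parametrisations of an edge and
  the common endpoints of different edges are identified automatically:
  \<open>edge_point u v t\<close> is the point of the edge \<open>uv\<close> at distance \<open>t\<close> from \<open>u\<close>, and it coincides
  with \<open>edge_point v u (1 - t)\<close>.
\<close>

definition vertex_point :: "'a \<Rightarrow> 'a \<Rightarrow> real" where
  "vertex_point u = (\<lambda>w. if w = u then 1 else 0)"

definition edge_point :: "'a \<Rightarrow> 'a \<Rightarrow> real \<Rightarrow> 'a \<Rightarrow> real" where
  "edge_point u v t = (\<lambda>w. if w = u then 1 - t else if w = v then t else 0)"

lemma edge_point_0: "edge_point u v 0 = vertex_point u"
  by (auto simp: edge_point_def vertex_point_def)

lemma edge_point_1: "u \<noteq> v \<Longrightarrow> edge_point u v 1 = vertex_point v"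
  by (auto simp: edge_point_def vertex_point_def)

lemma edge_point_swap: "u \<noteq> v \<Longrightarrow> edge_point v u (1 - t) = edge_point u v t"
  by (auto simp: edge_point_def)

definition metric_graph :: "'a pair_pre_digraph \<Rightarrow> ('a \<Rightarrow> real) set" where
  "metric_graph G = vertex_point ` pverts G \<union>
    {edge_point u v t | u v t. (u, v) \<in> parcs G \<and> 0 \<le> t \<and> t \<le> 1}"

text \<open>
  \<open>segment_path G x y l\<close>: a concatenation of finitely many segments, each contained in a single
  edge, leads from \<open>x\<close> to \<open>y\<close> and has total length \<open>l\<close>. The intrinsic distance is the infimum of
  these lengths.
\<close>

inductive segment_path ::
  "'a pair_pre_digraph \<Rightarrow> ('a \<Rightarrow> real) \<Rightarrow> ('a \<Rightarrow> real) \<Rightarrow> real \<Rightarrow> bool" for G where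
  refl: "x \<in> metric_graph G \<Longrightarrow> segment_path G x x 0"
| step: "segment_path G x (edge_point u v s) l \<Longrightarrow> (u, v) \<in> parcs G \<Longrightarrow>
    0 \<le> s \<Longrightarrow> s \<le> 1 \<Longrightarrow> 0 \<le> t \<Longrightarrow> t \<le> 1 \<Longrightarrow>
    segment_path G x (edge_point u v t) (l + \<bar>s - t\<bar>)"

definition metric_graph_dist ::
  "'a pair_pre_digraph \<Rightarrow> ('a \<Rightarrow> real) \<Rightarrow> ('a \<Rightarrow> real) \<Rightarrow> real" where
  "metric_graph_dist G x y = Inf {l. segment_path G x y l}"

end

theory Submission
  imports Defs
begin

text \<open>
  Lower bound: the robber uses constant agility 1 and runs from vertex to vertex. He plays the
  discrete game against shadows, which are vertices within distance 1/2 of the cops. If a cop at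
  \<open>x\<close> with shadow \<open>f\<close> moves to \<open>y\<close>, then \<open>y\<close> is within 3/2 of \<open>f\<close>, so a neighbour of \<open>f\<close> (or
  \<open>f\<close> itself) is within 1/2 of \<open>y\<close>. Strategies are positional, so the shadows are
  not remembered: any shadows from which the robber survives will do.

  Upper bound: while the robber moves from a vertex \<open>a\<close> along an edge towards \<open>b\<close>, \<open>k\<close> cops move
  at the same pace from their vertices towards their answers to the robber's move to \<open>b\<close>, and move
  back when he does. Every time he reaches another vertex the cops have answered, so if he is not
  caught he eventually stays in the open star of one vertex \<open>a\<close>. One more cop goes to \<open>a\<close> and
  from there follows him into a leg of that star, where he cannot escape.
\<close>

section \<open>The metric of a metric graph\<close>

text \<open>The distance is an infimum over segment paths, and no shortest path is ever constructed.
  Instead every path length is bounded below by one of finitely many candidates, so one candidate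
  bounds the infimum; from this come points at every intermediate distance, which is all that the
  players need of geodesics. In the continuous game the robber places the cops, while in the
  discrete game they place themselves; connectedness bridges this, since a discrete win from one
  start of the cops gives a win from every position. Agilities are unbounded, so one step may carry
  the robber through many vertices. The cops' answers within such a step come from an induction
  along his route, which works as long as no cop can be at his destination in time; otherwise he is
  caught at once.\<close>

locale connected_graph =
  fixes G :: "'a pair_pre_digraph"
  assumes finite_verts: "finite (pverts G)"
    and verts_nonempty: "pverts G \<noteq> {}"
    and arc_verts: "(u, v) \<in> parcs G \<Longrightarrow> u \<in> pverts G \<and> v \<in> pverts G"
    and arc_sym: "(u, v) \<in> parcs G \<Longrightarrow> (v, u) \<in> parcs G"
    and arc_neq: "(u, v) \<in> parcs G \<Longrightarrow> u \<noteq> v"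
    and verts_connected: "u \<in> pverts G \<Longrightarrow> v \<in> pverts G \<Longrightarrow> (u, v) \<in> (parcs G)\<^sup>*"
begin

abbreviation "V \<equiv> pverts G"
abbreviation "E \<equiv> parcs G"
abbreviation "X \<equiv> metric_graph G"
abbreviation "d \<equiv> metric_graph_dist G"
abbreviation "path \<equiv> segment_path G"
abbreviation "vp \<equiv> vertex_point :: 'a \<Rightarrow> 'a \<Rightarrow> real"
abbreviation "pt \<equiv> edge_point :: 'a \<Rightarrow> 'a \<Rightarrow> real \<Rightarrow> 'a \<Rightarrow> real"

lemma pt_simps [simp]:
  "pt a b s a = 1 - s" "a \<noteq> b \<Longrightarrow> pt a b s b = s" "w \<noteq> a \<Longrightarrow> w \<noteq> b \<Longrightarrow> pt a b s w = 0"
  "pt a b 0 = vp a"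
  by (auto simp: edge_point_def vertex_point_def)

lemma vp_simps [simp]: "vp a a = 1" "w \<noteq> a \<Longrightarrow> vp a w = 0" "vp a = vp b \<longleftrightarrow> a = b"
  by (auto simp: vertex_point_def fun_eq_iff split: if_splits)

lemma pt_1: "(a, b) \<in> E \<Longrightarrow> pt a b 1 = vp b"
  using arc_neq edge_point_1 by metis

lemma pt_swap: "(a, b) \<in> E \<Longrightarrow> pt b a (1 - s) = pt a b s"
  using arc_neq edge_point_swap by metis

lemma vp_in_X: "a \<in> V \<Longrightarrow> vp a \<in> X"
  by (auto simp: metric_graph_def)

lemma pt_in_X: "(a, b) \<in> E \<Longrightarrow> 0 \<le> s \<Longrightarrow> s \<le> 1 \<Longrightarrow> pt a b s \<in> X"
  by (auto simp: metric_graph_def)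

lemma X_cases [consumes 1, case_names vertex edge]:
  assumes "x \<in> X"
  obtains a where "a \<in> V" "x = vp a"
  | a b s where "(a, b) \<in> E" "0 < s" "s < 1" "x = pt a b s"
proof -
  from assms consider a where "a \<in> V" "x = vp a"
    | a b s where "(a, b) \<in> E" "0 \<le> s" "s \<le> 1" "x = pt a b s"
    by (auto simp: metric_graph_def)
  then show thesis
  proof cases
    case (2 a b s)
    then consider "s = 0" | "s = 1" | "0 < s" "s < 1" by linarith
    then show thesis
    proof cases
      assume "s = 0"
      then show thesis using 2 that(1)[of a] arc_verts by simp
    next
      assume "s = 1"
      then show thesis using 2 that(1)[of b] arc_verts pt_1 by simp
    qed (use 2 that in blast)
  qed (use that in auto)
qed

text \<open>Both end coordinates of an interior point are positive, so its support names its edge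
  and only the orientation stays free. A vertex lies on all its edges, hence the cases
  \<open>s = 0\<close> and \<open>s = 1\<close>.\<close>

lemma pt_eq_cases:
  assumes "pt a b s = pt u v p" "(a, b) \<in> E" "(u, v) \<in> E" "0 \<le> s" "s \<le> 1" "0 \<le> p" "p \<le> 1"
  shows "s = 0 \<or> s = 1 \<or> (u = a \<and> v = b \<and> p = s) \<or> (u = b \<and> v = a \<and> p = 1 - s)"
proof (rule ccontr)
  assume "\<not> ?thesis"
  then have s: "0 < s" "s < 1" and *: "\<not> (u = a \<and> v = b \<and> p = s)" "\<not> (u = b \<and> v = a \<and> p = 1 - s)"
    using assms by auto
  have ab: "a \<noteq> b" "u \<noteq> v" using assms arc_neq by auto
  have "pt u v p a = 1 - s" "pt u v p b = s" using assms(1) ab by (metis pt_simps)+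
  then show False using s * ab by (auto simp: edge_point_def split: if_splits)
qed

lemma pt_inj:
  assumes "pt a b s = pt a c p" "a \<noteq> b" "a \<noteq> c" "s > 0"
  shows "b = c \<and> s = p"
  using assms by (metis pt_simps less_irrefl diff_left_imp_eq)

section \<open>Segment paths\<close>

lemma path_in_X:
  assumes "path x y l"
  shows "x \<in> X" "y \<in> X" "0 \<le> l"
  using assms by (induction) (auto intro: pt_in_X)

lemma path_trans:
  assumes "path y z m" "path x y l"
  shows "path x z (l + m)"
  using assms
proof induction
  case (step y u v s m t)
  then show ?case using segment_path.step[of G x u v s "l + m" t] by (simp add: add.assoc)
qed simp

lemma path_edge:
  assumes "(u, v) \<in> E" "0 \<le> s" "s \<le> 1" "0 \<le> t" "t \<le> 1"
  shows "path (pt u v s) (pt u v t) \<bar>s - t\<bar>"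
proof -
  have "path (pt u v s) (pt u v s) 0" using assms by (intro segment_path.refl pt_in_X)
  from segment_path.step[OF this assms] show ?thesis by simp
qed

lemma path_sym:
  assumes "path x y l"
  shows "path y x l"
  using assms
proof induction
  case (refl x)
  then show ?case by (rule segment_path.refl)
next
  case (step x u v s l t)
  then show ?case using path_trans[OF step.IH path_edge[of u v t s]]
    by (simp add: add.commute abs_minus_commute)
qed

lemma path_vertices:
  assumes "u \<in> V" "v \<in> V"
  shows "\<exists>l. path (vp u) (vp v) l"
  using verts_connected[OF assms]
proof induction
  case base
  then show ?case using assms by (auto intro: segment_path.refl vp_in_X)
next
  case (step y z)
  then obtain l where "path (vp u) (vp y) l" by blast
  moreover have "path (vp y) (vp z) 1" using path_edge[of y z 0 1] step pt_1 by auto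
  ultimately show ?case using path_trans by blast
qed

lemma path_to_vertex:
  assumes "x \<in> X"
  shows "\<exists>u\<in>V. \<exists>l. path x (vp u) l"
  using assms
proof (cases rule: X_cases)
  case (vertex a)
  then show ?thesis by (auto intro: segment_path.refl vp_in_X)
next
  case (edge a b s)
  then show ?thesis using path_edge[of a b s 0] arc_verts by auto
qed

lemma path_exists:
  assumes "x \<in> X" "y \<in> X"
  shows "\<exists>l. path x y l"
  by (meson assms path_sym path_to_vertex path_trans path_vertices)

section \<open>The distance as an infimum of path lengths\<close>

lemma d_le: "path x y l \<Longrightarrow> d x y \<le> l"
  unfolding metric_graph_dist_def
  by (rule cInf_lower) (auto intro!: bdd_belowI[of _ 0] path_in_X(3))

lemma d_ge:
  assumes "x \<in> X" "y \<in> X" "\<And>l. path x y l \<Longrightarrow> c \<le> l"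
  shows "c \<le> d x y"
  unfolding metric_graph_dist_def
  by (rule cInf_greatest) (use assms path_exists in auto)

text \<open>Which element of \<open>J\<close> bounds a path may depend on the path, but
  \<open>Min J\<close> bounds them all and passes to the infimum. This stands in for the existence
  of a shortest path.\<close>

lemma d_ge_finite:
  assumes "x \<in> X" "y \<in> X" "finite J" "\<And>l. path x y l \<Longrightarrow> \<exists>j\<in>J. j \<le> l"
  shows "\<exists>j\<in>J. j \<le> d x y"
proof -
  have "J \<noteq> {}" using assms path_exists by blast
  moreover have "Min J \<le> d x y"
    using assms by (intro d_ge) (auto simp: Min_le_iff \<open>J \<noteq> {}\<close>)
  ultimately show ?thesis using Min_in assms(3) by blast
qed

lemma d_nonneg: "x \<in> X \<Longrightarrow> y \<in> X \<Longrightarrow> 0 \<le> d x y"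
  using d_ge path_in_X(3) by blast

lemma d_refl [simp]: "x \<in> X \<Longrightarrow> d x x = 0"
  using d_le[OF segment_path.refl] d_nonneg by force

lemma d_sym: "d x y = d y x"
proof -
  have "{l. path x y l} = {l. path y x l}" using path_sym by blast
  then show ?thesis by (simp add: metric_graph_dist_def)
qed

lemma d_triangle:
  assumes "x \<in> X" "y \<in> X" "z \<in> X"
  shows "d x z \<le> d x y + d y z"
proof -
  have "d x z - l \<le> d y z" if "path x y l" for l
    using assms(2,3)
  proof (rule d_ge)
    show "d x z - l \<le> m" if "path y z m" for m
      using d_le[OF path_trans[OF that \<open>path x y l\<close>]] by simp
  qed
  then have "d x z - d y z \<le> d x y"
    using assms by (intro d_ge) (auto simp: algebra_simps)
  then show ?thesis by simp
qed

lemma d_edge_le: "(a, b) \<in> E \<Longrightarrow> 0 \<le> s \<Longrightarrow> s \<le> 1 \<Longrightarrow> 0 \<le> t \<Longrightarrow> t \<le> 1 \<Longrightarrow> d (pt a b s) (pt a b t) \<le> \<bar>s - t\<bar>"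
  using d_le path_edge by blast

lemma d_adj_le: "(a, b) \<in> E \<Longrightarrow> d (vp a) (vp b) \<le> 1"
  using d_edge_le[of a b 0 1] pt_1 by auto

text \<open>No coordinate changes faster than 1 along a segment. Hence \<open>d\<close> separates
  points, and distinct vertices are at distance at least 1.\<close>

lemma coordinate_lipschitz:
  assumes "x \<in> X" "y \<in> X"
  shows "\<bar>x w - y w\<bar> \<le> d x y"
proof (rule d_ge[OF assms])
  fix l assume "path x y l"
  then show "\<bar>x w - y w\<bar> \<le> l"
  proof induction
    case (step x u v s l t)
    have "\<bar>pt u v s w - pt u v t w\<bar> \<le> \<bar>s - t\<bar>" by (auto simp: edge_point_def)
    then show ?case using step by linarith
  qed simp
qed

lemma d_eq_0:
  assumes "x \<in> X" "y \<in> X" "d x y \<le> 0"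
  shows "x = y"
proof
  show "x w = y w" for w using coordinate_lipschitz[OF assms(1,2), of w] assms(3) by linarith
qed

lemma d_vertices_ge: "u \<in> V \<Longrightarrow> v \<in> V \<Longrightarrow> u \<noteq> v \<Longrightarrow> 1 \<le> d (vp u) (vp v)"
  using coordinate_lipschitz[of "vp u" "vp v" u] vp_in_X by auto

section \<open>How a path leaves an edge or the star of a vertex\<close>

lemma path_from_edge:
  assumes "path x y l" "x = pt a b s" "(a, b) \<in> E" "0 \<le> s" "s \<le> 1"
  shows "(\<exists>s'. 0 \<le> s' \<and> s' \<le> 1 \<and> y = pt a b s' \<and> \<bar>s - s'\<bar> \<le> l)
    \<or> (\<exists>m. path (vp b) y m \<and> 1 - s + m \<le> l) \<or> (\<exists>m. path (vp a) y m \<and> s + m \<le> l)"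
  using assms
proof induction
  case (refl x)
  then show ?case by auto
next
  case (step x u v p l q)
  let ?m = "\<bar>p - q\<bar>"
  have uv: "path (pt u v p) (pt u v q) ?m" using step path_edge by blast
  consider s' where "0 \<le> s'" "s' \<le> 1" "pt u v p = pt a b s'" "\<bar>s - s'\<bar> \<le> l"
    | m where "path (vp b) (pt u v p) m" "1 - s + m \<le> l"
    | m where "path (vp a) (pt u v p) m" "s + m \<le> l"
    using step by blast
  then show ?case
  proof cases
    case 1
    \<comment> \<open>An interior point determines its edge, so the next segment runs in
      \<open>ab\<close> too; at an end of \<open>ab\<close> the count restarts from that
      vertex.\<close>
    then consider "s' = 0" | "s' = 1" | "u = a" "v = b" "p = s'" | "u = b" "v = a" "p = 1 - s'"
      using pt_eq_cases[of a b s' u v p] step by fastforce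
    then show ?thesis
    proof cases
      case 11: 1
      then have "path (vp a) (pt u v q) ?m" using uv 1 by simp
      moreover have "s + ?m \<le> l + ?m" using 1 11 by linarith
      ultimately show ?thesis by blast
    next
      case 11: 2
      then have "path (vp b) (pt u v q) ?m" using uv 1 pt_1 step by simp
      moreover have "1 - s + ?m \<le> l + ?m" using 1 11 by linarith
      ultimately show ?thesis by blast
    next
      case 11: 3
      have "\<bar>s - q\<bar> \<le> l + ?m" using 1 11 by linarith
      then show ?thesis using 11 step by blast
    next
      case 11: 4
      have "\<bar>s - (1 - q)\<bar> \<le> l + ?m" using 1 11 by linarith
      moreover have "pt u v q = pt a b (1 - q)" using 11 pt_swap[OF \<open>(a,b) \<in> E\<close>, of "1 - q"] by simp
      moreover have "0 \<le> 1 - q" "1 - q \<le> 1" using step by auto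
      ultimately show ?thesis by blast
    qed
  next
    case 2
    then have "path (vp b) (pt u v q) (m + ?m)" "1 - s + (m + ?m) \<le> l + ?m"
      using path_trans[OF uv] by auto
    then show ?thesis by blast
  next
    case 3
    then have "path (vp a) (pt u v q) (m + ?m)" "s + (m + ?m) \<le> l + ?m"
      using path_trans[OF uv] by auto
    then show ?thesis by blast
  qed
qed

lemma dist_from_edge_cases:
  assumes "(a, b) \<in> E" "0 \<le> s" "s \<le> 1" "y \<in> X"
  obtains s' where "0 \<le> s'" "s' \<le> 1" "y = pt a b s'" "\<bar>s - s'\<bar> \<le> d (pt a b s) y"
    | "1 - s + d (vp b) y \<le> d (pt a b s) y"
    | "s + d (vp a) y \<le> d (pt a b s) y"
proof -
  \<comment> \<open>The parameter \<open>s'\<close> is read off as the coordinate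
    \<open>y b\<close>, which makes the candidates independent of the path.\<close>
  let ?J = "{1 - s + d (vp b) y, s + d (vp a) y} \<union>
    (if \<exists>s'. 0 \<le> s' \<and> s' \<le> 1 \<and> y = pt a b s' then {\<bar>s - y b\<bar>} else {})"
  have "\<exists>j\<in>?J. j \<le> d (pt a b s) y"
  proof (rule d_ge_finite)
    fix l assume "path (pt a b s) y l"
    from path_from_edge[OF this HOL.refl assms(1-3)] show "\<exists>j\<in>?J. j \<le> l"
    proof (elim disjE exE conjE)
      fix m assume "path (vp b) y m" "1 - s + m \<le> l"
      then have "1 - s + d (vp b) y \<le> l" using d_le[of "vp b" y m] by linarith
      then show ?thesis by blast
    next
      fix m assume "path (vp a) y m" "s + m \<le> l"
      then have "s + d (vp a) y \<le> l" using d_le[of "vp a" y m] by linarith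
      then show ?thesis by blast
    next
      fix s' assume "0 \<le> s'" "s' \<le> 1" "y = pt a b s'" "\<bar>s - s'\<bar> \<le> l"
      moreover from this have "y b = s'" using assms arc_neq by auto
      ultimately have "\<bar>s - y b\<bar> \<in> ?J" "\<bar>s - y b\<bar> \<le> l" by auto
      then show ?thesis by blast
    qed
  qed (use assms pt_in_X in auto)
  then consider "1 - s + d (vp b) y \<le> d (pt a b s) y" | "s + d (vp a) y \<le> d (pt a b s) y"
    | s' where "0 \<le> s'" "s' \<le> 1" "y = pt a b s'" "\<bar>s - y b\<bar> \<le> d (pt a b s) y"
    by (auto split: if_splits)
  then show thesis
  proof cases
    case (3 s')
    then have "y b = s'" using assms arc_neq by auto
    then show thesis using 3 that(1) by simp
  qed (use that in blast)+
qed

text \<open>The open star: the far ends \<open>s = 1\<close> are left out, so that reaching a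
  neighbour counts as leaving. On it \<open>1 - x a\<close> is the distance from the centre,
  whatever the leg.\<close>

definition in_star :: "'a \<Rightarrow> ('a \<Rightarrow> real) \<Rightarrow> bool" where
  "in_star a x \<longleftrightarrow> x = vp a \<or> (\<exists>b s. (a, b) \<in> E \<and> 0 \<le> s \<and> s < 1 \<and> x = pt a b s)"

lemma in_star_leg:
  assumes "in_star a x" "x \<noteq> vp a"
  obtains b s where "(a, b) \<in> E" "0 < s" "s < 1" "x = pt a b s"
  using assms unfolding in_star_def by (metis order_le_less pt_simps(4))

lemma path_from_vertex:
  assumes "path x y l" "x = vp a"
  shows "in_star a y \<and> 1 - y a \<le> l
    \<or> (\<exists>b m. (a, b) \<in> E \<and> path (vp b) y m \<and> 1 + m \<le> l)"
  using assms
proof induction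
  case (refl x)
  then show ?case by (auto simp: in_star_def)
next
  case (step x u v p l q)
  let ?m = "\<bar>p - q\<bar>"
  have uv: "path (pt u v p) (pt u v q) ?m" using step path_edge by blast
  have leg: ?case if "(a, b) \<in> E" "0 \<le> s" "s \<le> 1" "pt u v q = pt a b s" "s \<le> l + ?m" for b s
  proof (cases "s < 1")
    case True
    then show ?thesis using that by (auto simp: in_star_def)
  next
    case False
    then have "s = 1" using that by simp
    then have "pt u v q = vp b" using that pt_1 by simp
    then have "path (vp b) (pt u v q) 0"
      using that arc_verts by (metis segment_path.refl vp_in_X)
    moreover have "1 + 0 \<le> l + ?m" using that \<open>s = 1\<close> by simp
    ultimately show ?thesis using that(1) by (intro disjI2 exI conjI)
  qed
  have vert: ?case if "pt u v p = vp a" "0 \<le> l"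
  proof -
    have "u \<noteq> v" using step arc_neq by auto
    then have "u = a \<and> p = 0 \<or> v = a \<and> p = 1"
      using fun_cong[OF that(1), of a] by (auto simp: edge_point_def split: if_splits)
    then show ?thesis
    proof
      assume "u = a \<and> p = 0"
      then show ?thesis using leg[of v q] step that by auto
    next
      assume "v = a \<and> p = 1"
      then show ?thesis using leg[of u "1 - q"] step that pt_swap[of a u "1 - q"] arc_sym by auto
    qed
  qed
  have l: "0 \<le> l" using step path_in_X(3) by blast
  consider b s where "(a, b) \<in> E" "0 < s" "s < 1" "pt u v p = pt a b s" "1 - pt u v p a \<le> l"
    | "pt u v p = vp a"
    | b m where "(a, b) \<in> E" "path (vp b) (pt u v p) m" "1 + m \<le> l"
    using step.IH[OF step.prems] in_star_leg[of a "pt u v p"] by metis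
  then show ?case
  proof cases
    case 1
    then have "s \<le> l" by simp
    have "(u = a \<and> v = b \<and> p = s) \<or> (u = b \<and> v = a \<and> p = 1 - s)"
      using pt_eq_cases[of a b s u v p] 1 step by fastforce
    then show ?thesis
    proof
      assume "u = a \<and> v = b \<and> p = s"
      moreover have "q \<le> l + \<bar>s - q\<bar>" using \<open>s \<le> l\<close> by linarith
      ultimately show ?thesis using leg[of b q] 1 step.hyps by auto
    next
      assume *: "u = b \<and> v = a \<and> p = 1 - s"
      have "1 - q \<le> l + ?m" using \<open>s \<le> l\<close> * by linarith
      moreover have "pt u v q = pt a b (1 - q)" using * pt_swap[of a b "1 - q"] 1 by simp
      moreover have "0 \<le> 1 - q" "1 - q \<le> 1" using step.hyps by auto
      ultimately show ?thesis using leg 1(1) by blast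
    qed
  next
    case 2
    then show ?thesis using vert l by blast
  next
    case 3
    then have "path (vp b) (pt u v q) (m + ?m)" "1 + (m + ?m) \<le> l + ?m"
      using path_trans[OF uv] by auto
    then show ?thesis using 3 by blast
  qed
qed

lemma dist_from_vertex_cases:
  assumes "a \<in> V" "y \<in> X"
  obtains "in_star a y" "1 - y a \<le> d (vp a) y"
    | b where "(a, b) \<in> E" "1 + d (vp b) y \<le> d (vp a) y"
proof -
  let ?N = "{b. (a, b) \<in> E}"
  let ?J = "(\<lambda>b. 1 + d (vp b) y) ` ?N \<union> (if in_star a y then {1 - y a} else {})"
  have "finite ?N" using finite_verts arc_verts by (auto intro: finite_subset)
  moreover have "\<exists>j\<in>?J. j \<le> l" if "path (vp a) y l" for l
    using path_from_vertex[OF that HOL.refl]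
  proof (elim disjE exE conjE)
    fix b m assume "(a, b) \<in> E" "path (vp b) y m" "1 + m \<le> l"
    moreover from this have "1 + d (vp b) y \<le> l" using d_le[of "vp b" y m] by linarith
    ultimately show ?thesis by blast
  qed simp
  ultimately have "\<exists>j\<in>?J. j \<le> d (vp a) y"
    using assms vp_in_X by (intro d_ge_finite) auto
  then show thesis using that by (auto split: if_splits)
qed

lemma in_star_dist:
  assumes "in_star a x" "a \<in> V"
  shows "d (vp a) x \<le> 1 - x a"
proof (cases "x = vp a")
  case True
  then show ?thesis using assms vp_in_X by simp
next
  case False
  then obtain b s where "(a, b) \<in> E" "0 < s" "s < 1" "x = pt a b s" using in_star_leg assms by metis
  then show ?thesis using d_edge_le[of a b 0 s] by auto
qed

text \<open>Passing to the nearer neighbour lowers a real distance by at least 1, so its integer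
  part is a well-founded measure. The rule follows the vertices of an optimal route without naming
  the route.\<close>

lemma d_from_vertex_induct [consumes 2, case_names star step]:
  assumes "a \<in> V" "y \<in> X"
    and "\<And>a. a \<in> V \<Longrightarrow> in_star a y \<Longrightarrow> 1 - y a \<le> d (vp a) y \<Longrightarrow> P a"
    and "\<And>a b. (a, b) \<in> E \<Longrightarrow> 1 + d (vp b) y \<le> d (vp a) y \<Longrightarrow> P b \<Longrightarrow> P a"
  shows "P a"
  using assms(1)
proof (induction "nat \<lfloor>d (vp a) y\<rfloor>" arbitrary: a rule: less_induct)
  case less
  from less.prems assms(2) show ?case
  proof (cases rule: dist_from_vertex_cases)
    case 1
    then show ?thesis using assms less.prems by blast
  next
    case (2 b)
    then have "b \<in> V" using arc_verts by auto
    then have "0 \<le> d (vp b) y" using d_nonneg vp_in_X assms by auto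
    then have "nat \<lfloor>d (vp b) y\<rfloor> < nat \<lfloor>d (vp a) y\<rfloor>" using 2 by linarith
    then show ?thesis using less \<open>b \<in> V\<close> 2 assms by blast
  qed
qed

section \<open>Points at intermediate distances\<close>

lemma between_from_vertex:
  assumes "a \<in> V" "y \<in> X" "0 \<le> t"
  shows "\<exists>z\<in>X. d (vp a) z \<le> t \<and> d z y \<le> max 0 (d (vp a) y - t)"
  using assms
proof (induction arbitrary: t rule: d_from_vertex_induct)
  case (star a)
  show ?case
  proof (cases "y = vp a")
    case True
    then show ?thesis using star vp_in_X by (auto intro!: bexI[of _ "vp a"])
  next
    case False
    then obtain b s where b: "(a, b) \<in> E" "0 < s" "s < 1" "y = pt a b s" using star in_star_leg by metis
    show ?thesis
    proof (rule bexI[of _ "pt a b (min s t)"])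
      show "d (vp a) (pt a b (min s t)) \<le> t \<and> d (pt a b (min s t)) y \<le> max 0 (d (vp a) y - t)"
        using d_edge_le[of a b 0 "min s t"] d_edge_le[of a b "min s t" s] b star
        by (auto simp: min_def max_def split: if_splits)
    qed (use b star in \<open>auto intro!: pt_in_X\<close>)
  qed
next
  case (step a b)
  have ab: "b \<in> V" "a \<in> V" using arc_verts step by auto
  show ?case
  proof (cases "t \<le> 1")
    case True
    have "d (pt a b t) (vp b) \<le> 1 - t" "d (vp a) (pt a b t) \<le> t"
      using d_edge_le[of a b t 1] d_edge_le[of a b 0 t] pt_1 step True by auto
    moreover have "d (pt a b t) y \<le> d (pt a b t) (vp b) + d (vp b) y"
      using d_triangle pt_in_X vp_in_X step ab True assms by auto
    ultimately have "d (pt a b t) y \<le> d (vp a) y - t" using step by linarith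
    then show ?thesis using step True \<open>d (vp a) (pt a b t) \<le> t\<close>
      by (auto intro!: bexI[of _ "pt a b t"] pt_in_X)
  next
    case False
    then obtain z where z: "z \<in> X" "d (vp b) z \<le> t - 1" "d z y \<le> max 0 (d (vp b) y - (t - 1))"
      using step.IH[of "t - 1"] by auto
    have "d (vp a) z \<le> d (vp a) (vp b) + d (vp b) z"
      using d_triangle vp_in_X ab z by auto
    then show ?thesis using z step d_adj_le[of a b] by (intro bexI[of _ z]) auto
  qed
qed

lemma between_via_vertex:
  assumes "(a, b) \<in> E" "0 \<le> s" "s \<le> 1" "y \<in> X" "0 \<le> t"
    and via: "1 - s + d (vp b) y \<le> d (pt a b s) y"
  shows "\<exists>z\<in>X. d (pt a b s) z \<le> t \<and> d z y \<le> max 0 (d (pt a b s) y - t)"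
proof -
  let ?x = "pt a b s"
  have b: "b \<in> V" and X: "?x \<in> X" "vp b \<in> X" using arc_verts assms pt_in_X vp_in_X by auto
  have xb: "d ?x (vp b) \<le> 1 - s" using d_edge_le[of a b s 1] assms pt_1 by auto
  show ?thesis
  proof (cases "t \<le> 1 - s")
    case True
    let ?z = "pt a b (s + t)"
    have z: "?z \<in> X" "d ?x ?z \<le> t" "d ?z (vp b) \<le> 1 - s - t"
      using True assms pt_in_X d_edge_le[of a b s "s + t"] d_edge_le[of a b "s + t" 1] pt_1 by auto
    moreover have "d ?z y \<le> d ?z (vp b) + d (vp b) y"
      using d_triangle z X assms by blast
    ultimately show ?thesis using via by (intro bexI[of _ ?z]) auto
  next
    case False
    then obtain z where z: "z \<in> X" "d (vp b) z \<le> t - (1 - s)"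
      "d z y \<le> max 0 (d (vp b) y - (t - (1 - s)))"
      using between_from_vertex[OF b, of y "t - (1 - s)"] assms by auto
    have "d ?x z \<le> d ?x (vp b) + d (vp b) z" using d_triangle z X by blast
    then show ?thesis using z xb via by (intro bexI[of _ z]) auto
  qed
qed

text \<open>The geodesic property in the form that a player uses: spending \<open>t\<close> shortens
  the distance by \<open>t\<close>, and \<open>max 0\<close> covers a budget that exceeds the
  distance.\<close>

lemma between:
  assumes "x \<in> X" "y \<in> X" "0 \<le> t"
  shows "\<exists>z\<in>X. d x z \<le> t \<and> d z y \<le> max 0 (d x y - t)"
  using assms(1)
proof (cases rule: X_cases)
  case (vertex a)
  then show ?thesis using between_from_vertex assms by blast
next
  case (edge a b s)
  then have s: "0 \<le> s" "s \<le> 1" by auto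
  from edge(1) s assms(2) show ?thesis
  proof (cases rule: dist_from_edge_cases)
    case (1 s')
    define p where "p = (if s \<le> s' then min s' (s + t) else max s' (s - t))"
    have "0 \<le> p" "p \<le> 1" "\<bar>s - p\<bar> \<le> t" "\<bar>p - s'\<bar> \<le> max 0 (\<bar>s - s'\<bar> - t)"
      using 1 s assms by (auto simp: p_def)
    moreover have "d (pt a b s) (pt a b p) \<le> \<bar>s - p\<bar>" "d (pt a b p) y \<le> \<bar>p - s'\<bar>"
      using d_edge_le edge 1 s calculation by auto
    ultimately show ?thesis using 1 edge pt_in_X by (intro bexI[of _ "pt a b p"]) auto
  next
    case 2
    then show ?thesis using between_via_vertex edge s assms by blast
  next
    case 3
    then show ?thesis
      using between_via_vertex[of b a "1 - s" y t] edge s assms arc_sym pt_swap by auto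
  qed
qed

end

section \<open>The discrete game\<close>

lemma tuples_iff: "c \<in> tuples Y k \<longleftrightarrow> (\<forall>i<k. c i \<in> Y) \<and> (\<forall>i. i \<ge> k \<longrightarrow> c i = undefined)"
  by (auto simp: tuples_def PiE_def Pi_def extensional_def not_less)

lemma restrict_in_tuples: "(\<And>i. i < k \<Longrightarrow> f i \<in> Y) \<Longrightarrow> restrict f {..<k} \<in> tuples Y k"
  by (auto simp: tuples_def)

definition cop_moves :: "'a pair_pre_digraph \<Rightarrow> nat \<Rightarrow> (nat \<Rightarrow> 'a) \<Rightarrow> (nat \<Rightarrow> 'a) \<Rightarrow> bool" where
  "cop_moves G k g g' \<longleftrightarrow> g' \<in> tuples (pverts G) k \<and> (\<forall>i<k. graph_move G (g i) (g' i))"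

text \<open>Evaluated when the robber is to move.\<close>

fun wins_within :: "'a pair_pre_digraph \<Rightarrow> nat \<Rightarrow> nat \<Rightarrow> 'a \<Rightarrow> (nat \<Rightarrow> 'a) \<Rightarrow> bool" where
  "wins_within G k 0 r g \<longleftrightarrow> (\<exists>i<k. g i = r)"
| "wins_within G k (Suc n) r g \<longleftrightarrow> wins_within G k n r g \<or>
    (\<forall>r'. graph_move G r r' \<longrightarrow> (\<exists>g'. cop_moves G k g g' \<and> wins_within G k n r' g'))"

definition cops_winning :: "'a pair_pre_digraph \<Rightarrow> nat \<Rightarrow> 'a \<Rightarrow> (nat \<Rightarrow> 'a) \<Rightarrow> bool" where
  "cops_winning G k r g \<longleftrightarrow> (\<exists>n. wins_within G k n r g)"

lemma wins_within_mono: "wins_within G k m r g \<Longrightarrow> m \<le> n \<Longrightarrow> wins_within G k n r g"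
  by (induction n) (auto simp: le_Suc_eq)

context connected_graph
begin

abbreviation "moves \<equiv> cop_moves G"
abbreviation "move \<equiv> graph_move G"

lemma move_iff: "u \<in> V \<Longrightarrow> move u v \<longleftrightarrow> u = v \<or> (u, v) \<in> E"
  using arc_verts by (auto simp: graph_move_def)

lemma moves_refl: "g \<in> tuples V k \<Longrightarrow> moves k g g"
  by (auto simp: cop_moves_def tuples_iff graph_move_def)

text \<open>\<open>cops_winning\<close> asks for one bound on the number of rounds. If every robber
  move had a winning answer, finiteness of the graph would bound the rounds needed uniformly, and
  one more round would win from \<open>(r, g)\<close>.\<close>

lemma robber_escapes:
  assumes "\<not> cops_winning G k r g"
  shows "\<exists>r'. move r r' \<and> (\<forall>g'. moves k g g' \<longrightarrow> \<not> cops_winning G k r' g')"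
proof (rule ccontr)
  assume "\<not> ?thesis"
  then have "\<forall>r'\<in>Collect (move r). \<exists>n g'. moves k g g' \<and> wins_within G k n r' g'"
    unfolding cops_winning_def by blast
  from bchoice[OF this] obtain n
    where "\<forall>r'\<in>Collect (move r). \<exists>g'. moves k g g' \<and> wins_within G k (n r') r' g'" ..
  then have n: "\<exists>g'. moves k g g' \<and> wins_within G k (n r') r' g'" if "move r r'" for r'
    using that by simp
  define m where "m = Max (n ` V)"
  have "\<exists>g'. moves k g g' \<and> wins_within G k m r' g'" if r': "move r r'" for r'
  proof -
    have "n r' \<le> m" using r' finite_verts by (auto simp: m_def graph_move_def)
    then show ?thesis using n[OF r'] wins_within_mono[of G k "n r'" r' _ m] by blast
  qed
  then have "wins_within G k (Suc m) r g" by simp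
  then show False using assms unfolding cops_winning_def by blast
qed

definition rank :: "nat \<Rightarrow> 'a \<Rightarrow> (nat \<Rightarrow> 'a) \<Rightarrow> nat" where
  "rank k r g = (LEAST n. wins_within G k n r g)"

text \<open>Minimality excludes a win with one round less, so the clause about answers must hold. A
  cop on \<open>r\<close> would make the rank 0 and leave no round to play.\<close>

lemma rank_response:
  assumes "cops_winning G k r g" "\<forall>i<k. g i \<noteq> r" "move r r'"
  shows "\<exists>g'. moves k g g' \<and> cops_winning G k r' g' \<and> rank k r' g' < rank k r g"
proof -
  have w: "wins_within G k (rank k r g) r g"
    using assms(1) unfolding cops_winning_def rank_def by (rule LeastI_ex)
  obtain n where n: "rank k r g = Suc n"
    using w assms(2) by (cases "rank k r g") auto
  have "\<not> wins_within G k n r g"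
    using not_less_Least[of n "\<lambda>n. wins_within G k n r g"] n unfolding rank_def by auto
  then obtain g' where g': "moves k g g'" "wins_within G k n r' g'"
    using w n assms(3) by auto
  then have "rank k r' g' \<le> n" unfolding rank_def by (intro Least_le)
  then show ?thesis using g' n cops_winning_def by (metis less_Suc_eq_le)
qed

lemma graph_cops_winI:
  assumes win: "\<And>r g. r \<in> V \<Longrightarrow> g \<in> tuples V k \<Longrightarrow> cops_winning G k r g"
  shows "graph_cops_win G k"
proof -
  \<comment> \<open>The default \<open>g\<close> is there because a strategy must give legal tuples
    on every list of vertices, not only on plays.\<close>
  define answer where "answer r0 r g = (if move r0 r \<and> (\<forall>i<k. g i \<noteq> r0)
    then SOME g'. moves k g g' \<and> rank k r g' < rank k r0 g else g)" for r0 r g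
  have answer_less: "moves k g (answer r0 r g) \<and> rank k r (answer r0 r g) < rank k r0 g"
    if "r0 \<in> V" "g \<in> tuples V k" "move r0 r" "\<forall>i<k. g i \<noteq> r0" for r0 r g
  proof -
    have "\<exists>g'. moves k g g' \<and> rank k r g' < rank k r0 g"
      using rank_response[OF win[OF that(1,2)] that(4,3)] by blast
    from someI_ex[OF this] show ?thesis using that by (simp add: answer_def)
  qed
  have answer_moves: "moves k g (answer r0 r g)" if "r0 \<in> V" "g \<in> tuples V k" for r0 r g
    using answer_less[OF that, of r] moves_refl[OF that(2)] by (cases "move r0 r \<and> (\<forall>i<k. g i \<noteq> r0)")
      (auto simp: answer_def)
  obtain v0 where v0: "v0 \<in> V" using verts_nonempty by blast
  define g0 where "g0 = (\<lambda>i\<in>{..<k}. v0)"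
  have g0: "g0 \<in> tuples V k" using v0 by (simp add: g0_def restrict_in_tuples)
  \<comment> \<open>The history is read latest position first, so that the recursion recomputes the
    cops' earlier positions. After the robber's placement the cops wait for one round.\<close>
  define strat where "strat = rec_list g0 (\<lambda>r h g. case h of [] \<Rightarrow> g0 | r0 # h' \<Rightarrow> answer r0 r g)"
  have strat_simps: "strat [] = g0" "strat [r] = g0"
    "strat (r # r0 # h) = answer r0 r (strat (r0 # h))" for r r0 h
    by (simp_all add: strat_def)
  have strat: "strat h \<in> tuples V k" if "set h \<subseteq> V" for h
    using that
  proof (induction h)
    case (Cons r h)
    then show ?case
      using answer_moves by (cases h) (auto simp: strat_simps g0 cop_moves_def)
  qed (simp add: strat_simps g0)
  show ?thesis
    unfolding graph_cops_win_def
  proof (intro exI conjI allI impI)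
    show "strat (rev h) \<in> tuples V k" if "set h \<subseteq> V" for h
      using strat that by simp
    fix r :: "nat \<Rightarrow> 'a"
    assume r: "\<forall>n. move (r n) (r (Suc n))"
    define c where "c = (\<lambda>n. strat (rev (map r [0..<n])))"
    have c_simps: "c 0 = g0" "c (Suc 0) = g0" "c (Suc (Suc n)) = answer (r n) (r (Suc n)) (c (Suc n))" for n
      by (simp_all add: c_def strat_simps)
    have V: "r n \<in> V" for n using r by (auto simp: graph_move_def)
    then have c: "c n \<in> tuples V k" for n by (auto simp: c_def intro!: strat)
    have "moves k (c n) (c (Suc n))" for n
    proof (cases n)
      case (Suc m)
      then show ?thesis using answer_moves V c by (simp add: c_simps)
    qed (simp add: c_simps moves_refl g0)
    moreover have "\<exists>n. \<exists>i<k. c n i = r n \<or> c (Suc n) i = r n"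
    proof (rule ccontr)
      assume "\<not> ?thesis"
      then have "rank k (r (Suc n)) (c (Suc (Suc n))) < rank k (r n) (c (Suc n))" for n
        using answer_less[OF V c, of n "r (Suc n)" "Suc n"] r by (auto simp: c_simps)
      then have "\<exists>f. \<forall>n. (f (Suc n) :: nat, f n) \<in> less_than"
        by (intro exI[of _ "\<lambda>n. rank k (r n) (c (Suc n))"]) simp
      then show False using wf_less_than[unfolded wf_iff_no_infinite_down_chain] by blast
    qed
    ultimately show "let c = \<lambda>n. strat (rev (map r [0..<n])) in
        (\<forall>n. \<forall>i<k. move (c n i) (c (Suc n) i)) \<and> (\<exists>n. \<exists>i<k. c n i = r n \<or> c (Suc n) i = r n)"
      unfolding Let_def c_def cop_moves_def by blast
  qed
qed

text \<open>The cops are walked from \<open>g\<close> to \<open>h\<close> one at a time, along walks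
  in the connected graph, while the others wait.\<close>

lemma moves_closed_reaches:
  assumes closed: "\<And>g g'. P g \<Longrightarrow> moves k g g' \<Longrightarrow> P g'"
    and g: "P g" "g \<in> tuples V k" and h: "h \<in> tuples V k"
  shows "P h"
proof -
  have single: "P (g(i := v))" if "P g" "g \<in> tuples V k" "i < k" "v \<in> V" for g i v
  proof -
    have "(g i, v) \<in> E\<^sup>*" using that verts_connected by (auto simp: tuples_iff)
    then show ?thesis
    proof induction
      case base
      then show ?case using that by simp
    next
      case (step y z)
      have "y \<in> V" "z \<in> V" using step arc_verts by auto
      then have "moves k (g(i := y)) (g(i := z))"
        using that step by (auto simp: cop_moves_def tuples_iff graph_move_def)
      then show ?case using closed step by blast
    qed
  qed
  have "P (\<lambda>i. if i < n then h i else g i) \<and> (\<lambda>i. if i < n then h i else g i) \<in> tuples V k"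
    if "n \<le> k" for n
    using that
  proof (induction n)
    case (Suc n)
    let ?f = "\<lambda>i. if i < n then h i else g i"
    have eq: "(\<lambda>i. if i < Suc n then h i else g i) = ?f(n := h n)"
      by (auto simp: fun_eq_iff less_Suc_eq)
    have "P (?f(n := h n))" using single[of ?f n "h n"] Suc h by (auto simp: tuples_iff)
    moreover have "?f(n := h n) \<in> tuples V k" using Suc h by (auto simp: tuples_iff)
    ultimately show ?case unfolding eq by blast
  qed (use g in simp)
  from this[of k] have "P (\<lambda>i. if i < k then h i else g i)" by simp
  moreover have "(\<lambda>i. if i < k then h i else g i) = h"
    using g(2) h by (auto simp: tuples_iff fun_eq_iff)
  ultimately show ?thesis by simp
qed

text \<open>If some robber position is safe against \<open>g\<close>, then his escape from it is
  safe after any cop move. So every cop position, \<open>q []\<close> included, leaves a safe robber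
  position, and from there he evades \<open>q\<close> forever.\<close>

lemma graph_cops_winD:
  assumes "graph_cops_win G k" "r \<in> V" "g \<in> tuples V k"
  shows "cops_winning G k r g"
proof (rule ccontr)
  assume lose: "\<not> cops_winning G k r g"
  from assms(1) obtain q where q: "\<And>h. set h \<subseteq> V \<Longrightarrow> q h \<in> tuples V k"
    and q_win: "\<And>r. \<forall>n. move (r n) (r (Suc n)) \<Longrightarrow>
      (\<forall>n. \<forall>i<k. move (q (map r [0..<n]) i) (q (map r [0..<Suc n]) i)) \<and>
      (\<exists>n. \<exists>i<k. q (map r [0..<n]) i = r n \<or> q (map r [0..<Suc n]) i = r n)"
    unfolding graph_cops_win_def Let_def by blast
  define flee where "flee r g = (if cops_winning G k r g then r else
    SOME r'. move r r' \<and> (\<forall>g'. moves k g g' \<longrightarrow> \<not> cops_winning G k r' g'))" for r g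
  have flee: "move r (flee r g)" "moves k g g' \<Longrightarrow> \<not> cops_winning G k (flee r g) g'"
    if "\<not> cops_winning G k r g" for r g g'
    using someI_ex[OF robber_escapes[OF that]] that by (auto simp: flee_def)
  have flee_move: "move r (flee r g)" if "r \<in> V" for r g
    using flee(1)[of r g] that by (cases "cops_winning G k r g") (auto simp: flee_def graph_move_def)
  have "\<exists>r\<in>V. \<not> cops_winning G k r (q [])"
  proof (rule moves_closed_reaches[where P = "\<lambda>g. \<exists>r\<in>V. \<not> cops_winning G k r g"])
    fix g g' assume "\<exists>r\<in>V. \<not> cops_winning G k r g" "moves k g g'"
    then show "\<exists>r\<in>V. \<not> cops_winning G k r g'"
      using flee by (metis graph_move_def)
  qed (use lose assms q in auto)
  then obtain r0 where r0: "r0 \<in> V" "\<not> cops_winning G k r0 (q [])" by blast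
  \<comment> \<open>\<open>cops_winning\<close> speaks of a robber about to move, but after his
    placement the cops move first. He is therefore placed at his escape from \<open>r0\<close>, not
    at \<open>r0\<close>.\<close>
  define H where "H = rec_nat [flee r0 (q [])] (\<lambda>n h. h @ [flee (last h) (q h)])"
  define r where "r n = last (H n)" for n
  have H: "H 0 = [flee r0 (q [])]" "H (Suc n) = H n @ [flee (r n) (q (H n))]" for n
    by (simp_all add: H_def r_def)
  have r_simps: "r 0 = flee r0 (q [])" "r (Suc n) = flee (r n) (q (H n))" for n
    unfolding r_def[of 0] r_def[of "Suc n"] H by simp_all
  have H_map: "H n = map r [0..<Suc n]" for n
    by (induction n) (simp_all add: H r_simps)
  have "r n \<in> V \<and> move (r n) (r (Suc n))" for n
    using flee_move r0 by (induction n) (auto simp: r_simps graph_move_def)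
  then have V: "r n \<in> V" and mv: "\<forall>n. move (r n) (r (Suc n))" for n by auto
  define c where "c n = q (map r [0..<n])" for n
  have c: "c n \<in> tuples V k" for n using V by (auto simp: c_def intro!: q)
  from q_win[OF mv] have cm: "moves k (c n) (c (Suc n))" for n
    using c[of "Suc n"] unfolding c_def cop_moves_def by blast
  obtain n i where caught: "i < k" "c n i = r n \<or> c (Suc n) i = r n"
    using q_win[OF mv] unfolding c_def by blast
  \<comment> \<open>Capture is tested before and after the cops' reply. The first half follows
    because staying put is also a cop move.\<close>
  have esc: "\<not> cops_winning G k (r n) (c n) \<and> \<not> cops_winning G k (r n) (c (Suc n))" for n
  proof (induction n)
    case 0
    have "c 0 = q []" by (simp add: c_def)
    then show ?case using flee(2)[OF r0(2)] cm[of 0] moves_refl c[of 0] by (simp add: r_simps)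
  next
    case (Suc n)
    have "q (H n) = c (Suc n)" by (simp add: c_def H_map)
    then show ?case using flee(2) Suc cm[of "Suc n"] moves_refl[OF c[of "Suc n"]]
      by (auto simp: r_simps)
  qed
  moreover have "cops_winning G k (r n) (c n) \<or> cops_winning G k (r n) (c (Suc n))"
    using caught wins_within.simps(1) unfolding cops_winning_def by metis
  ultimately show False by blast
qed

end

section \<open>Values of the game\<close>

context connected_graph
begin

lemma play_simps:
  "fst (play \<tau> p0 s q (Suc n)) = s (fst (play \<tau> p0 s q n)) (snd (play \<tau> p0 s q n)) (\<tau> (Suc n))"
  "snd (play \<tau> p0 s q (Suc n)) =
    q (fst (play \<tau> p0 s q (Suc n))) (snd (play \<tau> p0 s q n)) (\<tau> (Suc n))"
  by (auto simp: Let_def split: prod.splits)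

section \<open>The lower bound: evading the shadows\<close>

lemma vertex_tuple: "g \<in> tuples V k \<Longrightarrow> (\<lambda>i\<in>{..<k}. vp (g i)) \<in> tuples X k"
  by (rule restrict_in_tuples) (auto simp: tuples_iff vp_in_X)

text \<open>On a leg beyond its midpoint the far end is within 1/2 of \<open>y\<close>; nearer to
  the centre, \<open>f\<close> itself is. In the remaining case a neighbour is nearer to
  \<open>y\<close> by 1, which turns 3/2 into 1/2.\<close>

lemma shadow_step:
  assumes "f \<in> V" "y \<in> X" "d (vp f) y \<le> 3/2"
  shows "\<exists>g\<in>V. move f g \<and> d (vp g) y \<le> 1/2"
  using assms(1,2)
proof (cases rule: dist_from_vertex_cases)
  case 1
  show ?thesis
  proof (cases "1 - y f \<le> 1/2")
    case True
    then have "d (vp f) y \<le> 1/2" using in_star_dist 1 assms(1) by fastforce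
    then show ?thesis using assms(1) by (auto simp: move_iff intro!: bexI[of _ f])
  next
    case False
    then obtain b s where b: "(f, b) \<in> E" "0 < s" "s < 1" "y = pt f b s"
      using in_star_leg 1 by (metis diff_self vp_simps(1) zero_le_divide_1_iff zero_le_numeral)
    then have "d (vp b) y \<le> 1 - s" using d_edge_le[of f b 1 s] pt_1 by auto
    then show ?thesis using b False arc_verts assms(1) by (intro bexI[of _ b]) (auto simp: move_iff)
  qed
next
  case (2 b)
  then show ?thesis using arc_verts assms by (intro bexI[of _ b]) (auto simp: move_iff)
qed

lemma d_move_le: "move u v \<Longrightarrow> d (vp u) (vp v) \<le> 1"
  using d_adj_le vp_in_X by (auto simp: graph_move_def)

definition shadows :: "nat \<Rightarrow> 'a \<Rightarrow> (nat \<Rightarrow> 'a \<Rightarrow> real) \<Rightarrow> (nat \<Rightarrow> 'a) \<Rightarrow> bool" where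
  "shadows k r c g \<longleftrightarrow> r \<in> V \<and> g \<in> tuples V k \<and> \<not> cops_winning G k r g \<and>
    (\<forall>i<k. d (vp (g i)) (c i) \<le> 1/2)"

definition evasion :: "nat \<Rightarrow> ('a \<Rightarrow> real) \<Rightarrow> (nat \<Rightarrow> 'a \<Rightarrow> real) \<Rightarrow> real \<Rightarrow> 'a \<Rightarrow> bool" where
  "evasion k x c t r' \<longleftrightarrow> 1 \<le> t \<and> (\<exists>r g. x = vp r \<and> shadows k r c g \<and> move r r' \<and>
    (\<forall>g'. moves k g g' \<longrightarrow> \<not> cops_winning G k r' g'))"

text \<open>Staying at \<open>x\<close> when there is no escape makes this a legal strategy for all
  positions and all \<open>t\<close>.\<close>

definition evade :: "nat \<Rightarrow> ('a \<Rightarrow> real) \<Rightarrow> (nat \<Rightarrow> 'a \<Rightarrow> real) \<Rightarrow> real \<Rightarrow> 'a \<Rightarrow> real" where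
  "evade k x c t = (if \<exists>r'. evasion k x c t r' then vp (SOME r'. evasion k x c t r') else x)"

lemma evade_strategy: "evade k \<in> robber_strategies X d k"
proof -
  have "evade k x c t \<in> X \<and> d x (evade k x c t) \<le> t" if "x \<in> X" "0 \<le> t" for x c t
  proof (cases "\<exists>r'. evasion k x c t r'")
    case True
    from someI_ex[OF this] True obtain r r' where "evade k x c t = vp r'" "x = vp r" "move r r'" "1 \<le> t"
      unfolding evade_def evasion_def by (metis (no_types, lifting))
    then show ?thesis using d_move_le[of r r'] vp_in_X by (auto simp: graph_move_def)
  next
    case False
    then show ?thesis using that by (simp add: evade_def)
  qed
  then show ?thesis by (simp add: robber_strategies_def)
qed

lemma evade_shadow:
  assumes "shadows k r c g" "q \<in> cop_strategies X d k" "c \<in> tuples X k"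
  shows "\<exists>r' g'. evade k (vp r) c 1 = vp r' \<and> shadows k r' (q (vp r') c 1) g'"
proof -
  from assms(1) obtain r1 where "evasion k (vp r) c 1 r1"
    using robber_escapes[of k r g] unfolding shadows_def evasion_def by fastforce
  then have ex: "\<exists>r'. evasion k (vp r) c 1 r'" ..
  define r' where "r' = (SOME r'. evasion k (vp r) c 1 r')"
  have evade: "evade k (vp r) c 1 = vp r'" using ex by (simp add: evade_def r'_def)
  have "evasion k (vp r) c 1 r'" using someI_ex[OF ex] by (simp add: r'_def)
  \<comment> \<open>The shadows \<open>g1\<close> behind the chosen escape may differ from the given
    \<open>g\<close>, which only shows that an escape exists. The new shadows continue
    \<open>g1\<close>.\<close>
  then obtain g1 where r': "shadows k r c g1" "move r r'"
    and esc: "\<And>g'. moves k g1 g' \<Longrightarrow> \<not> cops_winning G k r' g'"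
    by (auto simp: evasion_def)
  have V: "r' \<in> V" using r' by (auto simp: graph_move_def)
  define c' where "c' = q (vp r') c 1"
  have c': "c' \<in> tuples X k" "\<And>i. i < k \<Longrightarrow> d (c i) (c' i) \<le> 1"
    using assms V vp_in_X by (auto simp: cop_strategies_def c'_def)
  have "\<exists>v\<in>V. move (g1 i) v \<and> d (vp v) (c' i) \<le> 1/2" if "i < k" for i
  proof (rule shadow_step)
    have X: "g1 i \<in> V" "vp (g1 i) \<in> X" "c i \<in> X" "c' i \<in> X"
      using that r'(1) c' assms(3) vp_in_X by (auto simp: shadows_def tuples_iff)
    then show "g1 i \<in> V" "c' i \<in> X" by auto
    have "d (vp (g1 i)) (c i) \<le> 1/2" using r'(1) that by (auto simp: shadows_def)
    then show "d (vp (g1 i)) (c' i) \<le> 3/2"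
      using d_triangle[OF X(2-4)] c'(2)[OF that] by linarith
  qed
  then obtain h where h: "\<And>i. i < k \<Longrightarrow> h i \<in> V \<and> move (g1 i) (h i) \<and> d (vp (h i)) (c' i) \<le> 1/2"
    by metis
  let ?g = "restrict h {..<k}"
  have "?g \<in> tuples V k" using h by (auto intro: restrict_in_tuples)
  then have "moves k g1 ?g" using h by (auto simp: cop_moves_def)
  then have "shadows k r' c' ?g"
    using h V esc \<open>?g \<in> tuples V k\<close> by (auto simp: shadows_def)
  then show ?thesis using evade c'_def by blast
qed

text \<open>A shadow on the robber's vertex would be a win in 0 rounds. So the two vertices are at
  distance at least 1, of which the cop's distance to his shadow uses up at most 1/2.\<close>

lemma shadows_dist:
  assumes "shadows k r c g" "c \<in> tuples X k" "i < k"
  shows "1/2 \<le> d (vp r) (c i)"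
proof -
  have "g i \<noteq> r"
    using assms wins_within.simps(1)[of G k r g] unfolding shadows_def cops_winning_def by blast
  moreover have V: "g i \<in> V" "r \<in> V" "c i \<in> X" using assms by (auto simp: shadows_def tuples_iff)
  ultimately have "1 \<le> d (vp r) (vp (g i))" using d_vertices_ge by auto
  also have "\<dots> \<le> d (vp r) (c i) + d (c i) (vp (g i))" using V vp_in_X d_triangle by auto
  finally show ?thesis using assms by (auto simp: shadows_def d_sym[of "c i"])
qed

lemma robber_wins:
  assumes "\<not> cops_winning G k r0 g0" "r0 \<in> V" "g0 \<in> tuples V k" "1 \<le> k"
  shows "ereal (1/2) \<le> val_C X d k"
proof -
  define p0 where "p0 = (vp r0, \<lambda>i\<in>{..<k}. vp (g0 i))"
  define \<tau> :: "nat \<Rightarrow> real" where "\<tau> = (\<lambda>n. 1)"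
  have "\<tau> \<in> agilities"
    using filterlim_real_sequentially by (simp add: agilities_def \<tau>_def)
  moreover have "p0 \<in> X \<times> tuples X k" using assms vertex_tuple vp_in_X by (auto simp: p0_def)
  moreover have "ereal (1/2) \<le> (INF q\<in>cop_strategies X d k. game_value d k (play \<tau> p0 (evade k) q))"
  proof (rule INF_greatest)
    fix q assume q: "q \<in> cop_strategies X d k"
    let ?P = "play \<tau> p0 (evade k) q"
    have inv: "\<exists>r g. fst (?P n) = vp r \<and> snd (?P n) \<in> tuples X k \<and> shadows k r (snd (?P n)) g" for n
    proof (induction n)
      case 0
      have "shadows k r0 (snd p0) g0"
        using assms vp_in_X by (auto simp: shadows_def p0_def tuples_iff)
      moreover have "fst (?P 0) = vp r0" "?P 0 = p0" by (simp_all add: p0_def)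
      moreover have "snd p0 \<in> tuples X k" using \<open>p0 \<in> _\<close> by auto
      ultimately show ?case by metis
    next
      case (Suc n)
      then obtain r g where rg: "fst (?P n) = vp r" "snd (?P n) \<in> tuples X k"
        "shadows k r (snd (?P n)) g" by blast
      from evade_shadow[OF rg(3) q rg(2)] obtain r' g'
        where r': "evade k (vp r) (snd (?P n)) 1 = vp r'"
          "shadows k r' (q (vp r') (snd (?P n)) 1) g'" by blast
      have 1: "fst (?P (Suc n)) = vp r'" "snd (?P (Suc n)) = q (vp r') (snd (?P n)) 1"
        using r' rg by (simp_all only: play_simps \<tau>_def)
      have "r' \<in> V" using r' by (auto simp: shadows_def)
      then have "snd (?P (Suc n)) \<in> tuples X k"
        using q rg vp_in_X unfolding 1 by (auto simp: cop_strategies_def)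
      then show ?case using r' 1 by metis
    qed
    have ge: "1/2 \<le> d (fst (?P n)) (snd (?P n) i)" if "i < k" for n i
      using inv[of n] shadows_dist that by auto
    have "snd (?P n) i \<noteq> fst (?P n)" if "i < k" for n i
    proof
      assume "snd (?P n) i = fst (?P n)"
      moreover have "snd (?P n) i \<in> X" using inv[of n] that by (auto simp: tuples_iff)
      ultimately show False using ge[OF that, of n] by auto
    qed
    moreover have "{..<k} \<noteq> {}" using assms(4) by (simp add: lessThan_empty_iff)
    then have "1/2 \<le> Min ((\<lambda>i. d (fst (?P n)) (snd (?P n) i)) ` {..<k})" for n
      using ge by (subst Min_ge_iff) auto
    then have "ereal (1/2) \<le> (INF n. ereal (Min ((\<lambda>i. d (fst (?P n)) (snd (?P n) i)) ` {..<k})))"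
      by (intro INF_greatest) (simp del: play.simps)
    ultimately show "ereal (1/2) \<le> game_value d k ?P"
      unfolding game_value_def by (auto simp del: play.simps)
  qed
  ultimately show ?thesis
    unfolding val_C_def
    using evade_strategy
    by (intro SUP_upper2[of \<tau>] SUP_upper2[of "(p0, evade k)"]) auto
qed

lemma graph_cops_win_if_val_0:
  assumes "val_C X d k = 0" "1 \<le> k"
  shows "graph_cops_win G k"
proof (rule graph_cops_winI, rule ccontr)
  fix r g assume "r \<in> V" "g \<in> tuples V k" "\<not> cops_winning G k r g"
  from robber_wins[OF this(3,1,2) assms(2)] show False using assms(1) by (simp add: zero_ereal_def)
qed

text \<open>One agility, one start and one robber strategy bound the supremum from below;
  \<open>evade k\<close> serves merely as a legal strategy. This turns an upper bound 0 into the
  equality that defines a win.\<close>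

lemma val_C_nonneg:
  assumes "1 \<le> k"
  shows "0 \<le> val_C X d k"
proof -
  obtain v where v: "v \<in> V" using verts_nonempty by blast
  define p0 where "p0 = (vp v, \<lambda>i\<in>{..<k}. vp v)"
  define \<tau> :: "nat \<Rightarrow> real" where "\<tau> = (\<lambda>n. 1)"
  have \<tau>: "\<tau> \<in> agilities"
    using filterlim_real_sequentially by (simp add: agilities_def \<tau>_def)
  have p0: "p0 \<in> X \<times> tuples X k" using v vp_in_X by (auto simp: p0_def intro: restrict_in_tuples)
  have "0 \<le> game_value d k (play \<tau> p0 (evade k) q)" if q: "q \<in> cop_strategies X d k" for q
  proof -
    let ?P = "play \<tau> p0 (evade k) q"
    have "fst (?P n) \<in> X \<and> snd (?P n) \<in> tuples X k" for n
    proof (induction n)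
      case (Suc n)
      then have "fst (?P (Suc n)) \<in> X"
        using evade_strategy[of k] unfolding play_simps \<tau>_def by (simp add: robber_strategies_def)
      then show ?case
        using q Suc unfolding play_simps(2) \<tau>_def by (simp add: cop_strategies_def)
    qed (use p0 in auto)
    then have "fst (?P n) \<in> X \<and> (\<forall>i<k. snd (?P n) i \<in> X)" for n by (simp add: tuples_iff)
    then show ?thesis using assms
      by (auto simp: game_value_def Min_ge_iff lessThan_empty_iff d_nonneg intro!: INF_greatest simp del: play.simps)
  qed
  then have "0 \<le> (INF q\<in>cop_strategies X d k. game_value d k (play \<tau> p0 (evade k) q))"
    by (rule INF_greatest)
  then show ?thesis
    unfolding val_C_def
    using evade_strategy p0 \<tau>
    by (intro SUP_upper2[of \<tau>] SUP_upper2[of "(p0, evade k)"]) auto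
qed

lemma val_0_if_cops_catch:
  assumes "cops_catch X d k" "1 \<le> k"
  shows "val_C X d k = 0"
proof (rule antisym)
  show "0 \<le> val_C X d k" using assms by (rule_tac val_C_nonneg)
  have "(INF q\<in>cop_strategies X d k. game_value d k (play \<tau> p0 s q)) \<le> 0"
    if \<tau>: "\<tau> \<in> agilities" and p0: "p0 \<in> X \<times> tuples X k" and s: "s \<in> robber_strategies X d k"
    for \<tau> p0 s
  proof -
    from assms(1) \<tau> obtain q where q: "q \<in> cop_strategies X d k"
      and catch: "\<And>r c. (\<forall>n. r n \<in> X) \<Longrightarrow> c 0 \<in> tuples X k \<Longrightarrow>
        (\<forall>n. d (r n) (r (Suc n)) \<le> \<tau> (Suc n)) \<Longrightarrow>
        (\<forall>n. c (Suc n) = q (r (Suc n)) (c n) (\<tau> (Suc n))) \<Longrightarrow> (\<exists>n. \<exists>i<k. c n i = r n)"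
      unfolding cops_catch_def by metis
    let ?P = "play \<tau> p0 s q"
    have t: "0 \<le> \<tau> (Suc n)" for n using \<tau> by (auto simp: agilities_def)
    have X: "fst (?P n) \<in> X \<and> snd (?P n) \<in> tuples X k" for n
    proof (induction n)
      case (Suc n)
      then have "fst (?P (Suc n)) \<in> X"
        using s t unfolding play_simps by (simp add: robber_strategies_def)
      then show ?case
        using q t Suc unfolding play_simps(2) by (simp add: cop_strategies_def)
    qed (use p0 in auto)
    have "\<exists>n. \<exists>i<k. snd (?P n) i = fst (?P n)"
    proof (rule catch)
      show "\<forall>n. d (fst (?P n)) (fst (?P (Suc n))) \<le> \<tau> (Suc n)"
        using s t X unfolding play_simps by (simp add: robber_strategies_def)
      show "\<forall>n. snd (?P (Suc n)) = q (fst (?P (Suc n))) (snd (?P n)) (\<tau> (Suc n))"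
        using play_simps(2) by blast
    qed (use X in blast)+
    then have "game_value d k ?P = 0" by (simp add: game_value_def del: play.simps)
    then show ?thesis using q by (metis INF_lower)
  qed
  then show "val_C X d k \<le> 0"
    unfolding val_C_def by (auto intro!: SUP_least simp del: play.simps)
qed

end

section \<open>Catching the robber with one more cop\<close>

text \<open>The divergence of the agility enters the capture here: what gains \<open>\<tau>\<close>
  in every step cannot stay bounded. Both the gathering of the cops and the chase rest on
  it.\<close>

lemma drift_unbounded:
  fixes f :: "nat \<Rightarrow> real"
  assumes \<tau>: "\<tau> \<in> agilities"
    and step: "\<And>n. n0 \<le> n \<Longrightarrow> f n + \<tau> (Suc n) \<le> f (Suc n)"
    and bound: "\<And>n. n0 \<le> n \<Longrightarrow> f n \<le> B"
  shows False
proof -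
  define T where "T n = (\<Sum>i=1..n. \<tau> i)" for n
  have T: "f n0 + (T n - T n0) \<le> f n" if "n0 \<le> n" for n
    using that by (induction rule: dec_induct) (use step in \<open>fastforce simp: T_def\<close>)+
  have "\<forall>\<^sub>F n in sequentially. B - f n0 + T n0 < T n"
    using \<tau> by (simp add: agilities_def T_def filterlim_at_top_dense)
  then have "\<forall>\<^sub>F n in sequentially. B - f n0 + T n0 < T n \<and> n0 \<le> n"
    using eventually_ge_at_top[of n0] by (rule eventually_conj)
  then obtain n where "B - f n0 + T n0 < T n" "n0 \<le> n"
    using eventually_happens by fastforce
  then show False using T[of n] bound[of n] by linarith
qed

lemma approach_arrives:
  fixes D :: "nat \<Rightarrow> real"
  assumes \<tau>: "\<tau> \<in> agilities"
    and step: "\<And>n. n0 \<le> n \<Longrightarrow> D (Suc n) \<le> max 0 (D n - \<tau> (Suc n))"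
  shows "\<exists>m\<ge>n0. \<forall>n\<ge>m. D n \<le> 0"
proof -
  have "\<exists>m\<ge>n0. D m \<le> 0"
  proof (rule ccontr)
    assume "\<not> ?thesis"
    then have pos: "0 < D n" if "n0 \<le> n" for n using that not_le by blast
    show False
      using \<tau>
    proof (rule drift_unbounded)
      show "- D n + \<tau> (Suc n) \<le> - D (Suc n)" if "n0 \<le> n" for n
        using step[OF that] pos[of "Suc n"] that by linarith
      show "- D n \<le> 0" if "n0 \<le> n" for n using pos[OF that] by simp
    qed
  qed
  then obtain m where m: "n0 \<le> m" "D m \<le> 0" by blast
  have "D n \<le> 0" if "m \<le> n" for n
    using that
  proof (induction rule: dec_induct)
    case (step n)
    have "0 \<le> \<tau> (Suc n)" using \<tau> by (auto simp: agilities_def)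
    then show ?case using assms(2)[of n] step m by auto
  qed (rule m)
  then show ?thesis using m by blast
qed

text \<open>\<open>N\<close> is a two-digit number in base \<open>M\<close>: the high digit is
  \<open>L\<close>, the low digit \<open>h\<close> enumerates the pairs \<open>(a, g)\<close> below
  \<open>M\<close>. A drop of \<open>L\<close> outweighs any change of \<open>h\<close>, and equal
  values have equal digits.\<close>

lemma (in connected_graph) potential_exists:
  assumes win: "\<And>r g. r \<in> V \<Longrightarrow> g \<in> tuples V k \<Longrightarrow> cops_winning G k r g"
  obtains N :: "bool \<times> 'a \<times> (nat \<Rightarrow> 'a) \<Rightarrow> nat" and R
  where "inj_on N (UNIV \<times> V \<times> tuples V k)"
    and "\<And>f a g b. (a, b) \<in> E \<Longrightarrow> g \<in> tuples V k \<Longrightarrow> \<forall>i<k. g i \<noteq> a \<Longrightarrow>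
      moves k g (R f a g b) \<and> N (True, b, R f a g b) < N (f, a, g)"
    and "\<And>a g b. R False a g b = g"
proof -
  let ?S = "V \<times> tuples V k"
  define M where "M = card ?S"
  have fin: "finite ?S" using finite_verts by (simp add: tuples_def finite_PiE)
  obtain h where "bij_betw h ?S {0..<M}"
    using ex_bij_betw_finite_nat[OF fin] unfolding M_def by blast
  then have h_inj: "inj_on h ?S" and h_less: "\<And>p. p \<in> ?S \<Longrightarrow> h p < M"
    by (auto simp: bij_betw_def)
  \<comment> \<open>\<open>K\<close> exceeds all ranks: waiting states lie above those of the
    discrete game, so joining it is a decrease, and \<open>N\<close> tells the two flags
    apart.\<close>
  define K where "K = Suc (Max ((\<lambda>(a, g). rank k a g) ` ?S))"
  have K: "rank k a g < K" if "(a, g) \<in> ?S" for a g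
    using that fin unfolding K_def less_Suc_eq_le by (intro Max_ge) auto
  define L where "L f a g = (if f then rank k a g else K)" for f a g
  define N where "N = (\<lambda>(f, a, g). L f a g * M + h (a, g))"
  define R where "R f a g b = (if f then SOME g'. moves k g g' \<and> rank k b g' < rank k a g else g)" for f a g b
  have N_less: "N (f', a', g') < N (f, a, g)"
    if "L f' a' g' < L f a g" "(a', g') \<in> ?S" for f f' a a' g g'
  proof -
    have "N (f', a', g') < Suc (L f' a' g') * M" using h_less[OF that(2)] by (simp add: N_def)
    also have "\<dots> \<le> L f a g * M" using that(1) by (intro mult_le_mono1) simp
    finally show ?thesis by (simp add: N_def)
  qed
  show thesis
  proof (rule that[of N R])
    show "inj_on N (UNIV \<times> ?S)"
    proof (rule inj_onI, clarsimp)
      fix f a g f' a' g'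
      assume *: "N (f, a, g) = N (f', a', g')" "a \<in> V" "g \<in> tuples V k" "a' \<in> V" "g' \<in> tuples V k"
      then have L: "L f a g = L f' a' g'"
        using N_less[of f a g f' a' g'] N_less[of f' a' g' f a g] by (metis SigmaI linorder_neqE_nat less_irrefl)
      then have "h (a, g) = h (a', g')" using * by (simp add: N_def)
      then have "a = a'" "g = g'" using inj_onD[OF h_inj] * by auto
      moreover have "f = f'" using L K[of a g] * calculation by (auto simp: L_def split: if_splits)
      ultimately show "f = f' \<and> a = a' \<and> g = g'" by simp
    qed
    fix f a g b
    assume *: "(a, b) \<in> E" "g \<in> tuples V k" "\<forall>i<k. g i \<noteq> a"
    then have ab: "a \<in> V" "b \<in> V" using arc_verts by auto
    show "moves k g (R f a g b) \<and> N (True, b, R f a g b) < N (f, a, g)"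
    proof (cases f)
      case True
      have "\<exists>g'. moves k g g' \<and> rank k b g' < rank k a g"
        using rank_response[OF win[OF ab(1) *(2)] *(3), of b] * ab by (auto simp: move_iff)
      from someI_ex[OF this] have 1: "moves k g (R f a g b)" "rank k b (R f a g b) < rank k a g"
        using True by (auto simp: R_def)
      then have "R f a g b \<in> tuples V k" by (simp add: cop_moves_def)
      then show ?thesis using 1 True ab N_less by (simp add: L_def)
    next
      case False
      then show ?thesis using * ab moves_refl N_less[of True b g f a g] K by (simp add: L_def R_def)
    qed
  qed (simp add: R_def)
qed

text \<open>
  A state \<open>(f, a, g)\<close> has the robber leaving the vertex \<open>a\<close> and the cops leaving the vertices \<open>g\<close>.
  The flag \<open>f = False\<close> is for cops who wait at \<open>g\<close> because the game reached them with the robber in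
  the middle of an edge; they join the discrete game when he reaches a vertex. The potential \<open>N\<close>
  is injective so that a constant potential fixes the vertex \<open>a\<close>.
\<close>

locale pursuit = connected_graph G for G :: "'a pair_pre_digraph" +
  fixes k :: nat
    and N :: "bool \<times> 'a \<times> (nat \<Rightarrow> 'a) \<Rightarrow> nat"
    and R :: "bool \<Rightarrow> 'a \<Rightarrow> (nat \<Rightarrow> 'a) \<Rightarrow> 'a \<Rightarrow> nat \<Rightarrow> 'a"
  assumes N_inj: "inj_on N (UNIV \<times> pverts G \<times> tuples (pverts G) k)"
    and R_less: "(a, b) \<in> parcs G \<Longrightarrow> g \<in> tuples (pverts G) k \<Longrightarrow> \<forall>i<k. g i \<noteq> a \<Longrightarrow>
      cop_moves G k g (R f a g b) \<and> N (True, b, R f a g b) < N (f, a, g)"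
    and R_wait: "R False a g b = g"
begin

text \<open>
  The distance bounds let the cops get to \<open>g\<close> in time if the robber returns to \<open>a\<close>, and to their
  answers if he proceeds to \<open>b\<close>.
\<close>

fun valid :: "bool \<times> 'a \<times> (nat \<Rightarrow> 'a) \<Rightarrow> ('a \<Rightarrow> real) \<Rightarrow> (nat \<Rightarrow> 'a \<Rightarrow> real) \<Rightarrow> bool" where
  "valid (f, a, g) r c \<longleftrightarrow> a \<in> V \<and> g \<in> tuples V k \<and> (\<forall>i<k. g i \<noteq> a \<and> c i \<in> X) \<and>
    (r = vp a \<and> (\<forall>i<k. c i = vp (g i)) \<or>
     (\<exists>b s. (a, b) \<in> E \<and> 0 \<le> s \<and> s < 1 \<and> r = pt a b s \<and>
       (\<forall>i<k. d (c i) (vp (g i)) \<le> s \<and> d (c i) (vp (R f a g b i)) \<le> 1 - s)))"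

text \<open>Sharper than \<open>d r r' \<le> t\<close>: the length is realised inside the star of
  \<open>a\<close>, through the centre or along one leg. A shortcut outside the star passes another
  vertex and lowers the potential instead.\<close>

definition close :: "'a \<Rightarrow> ('a \<Rightarrow> real) \<Rightarrow> ('a \<Rightarrow> real) \<Rightarrow> real \<Rightarrow> bool" where
  "close a r r' t \<longleftrightarrow> (1 - r a) + (1 - r' a) \<le> t \<or>
    (\<exists>b s s'. (a, b) \<in> E \<and> 0 \<le> s \<and> s < 1 \<and> 0 \<le> s' \<and> s' < 1 \<and> r = pt a b s \<and> r' = pt a b s' \<and> \<bar>s - s'\<bar> \<le> t)"

lemma valid_in_star: "valid (f, a, g) r c \<Longrightarrow> a \<in> V \<and> in_star a r"
  by (auto simp: in_star_def)

lemma R_adj: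
  assumes "(a, b) \<in> E" "g \<in> tuples V k" "\<forall>i<k. g i \<noteq> a" "i < k"
  shows "g i \<in> V" "R f a g b i \<in> V" "d (vp (g i)) (vp (R f a g b i)) \<le> 1"
proof -
  have "move (g i) (R f a g b i)" using R_less[OF assms(1-3)] assms(4) by (auto simp: cop_moves_def)
  then show "g i \<in> V" "R f a g b i \<in> V" "d (vp (g i)) (vp (R f a g b i)) \<le> 1"
    using d_move_le by (auto simp: graph_move_def)
qed

text \<open>The cops answer at each vertex that the robber passes, and \<open>N\<close> drops each
  time. The strict inequality says that no cop can be at \<open>y\<close> as soon as he; it survives
  an answer, since he comes nearer by at least 1 and a cop by at most 1, and it keeps the cops off
  his vertex, as \<open>R_less\<close> demands.\<close>

lemma valid_from_vertex:
  assumes "a \<in> V" "y \<in> X" "g \<in> tuples V k" "\<And>i. i < k \<Longrightarrow> d (vp a) y < d (vp (g i)) y"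
  shows "\<exists>\<sigma> c. valid \<sigma> y c \<and> (\<forall>i<k. d (vp (g i)) (c i) \<le> d (vp a) y) \<and>
    (N \<sigma> < N (f, a, g) \<or> \<sigma> = (f, a, g) \<and> 1 - y a \<le> d (vp a) y)"
  using assms
proof (induction arbitrary: f g rule: d_from_vertex_induct)
  case (star a)
  have free: "\<forall>i<k. g i \<noteq> a" using star.prems by fastforce
  have gV: "g i \<in> V" if "i < k" for i using star.prems(1) that by (auto simp: tuples_iff)
  show ?case
  proof (cases "y = vp a")
    case True
    have "valid (f, a, g) y (\<lambda>i. vp (g i))"
      using True star free gV vp_in_X by auto
    then show ?thesis using star gV vp_in_X True
      by (intro exI[of _ "(f, a, g)"] exI[of _ "\<lambda>i. vp (g i)"]) auto
  next
    case False
    then obtain b s where b: "(a, b) \<in> E" "0 < s" "s < 1" "y = pt a b s" using star in_star_leg by metis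
    have "\<exists>z\<in>X. d (vp (g i)) z \<le> s \<and> d z (vp (R f a g b i)) \<le> 1 - s" if "i < k" for i
    proof -
      note R = R_adj[OF b(1) star.prems(1) free that]
      obtain z where "z \<in> X" "d (vp (g i)) z \<le> s"
        "d z (vp (R f a g b i)) \<le> max 0 (d (vp (g i)) (vp (R f a g b i)) - s)"
        using between[of "vp (g i)" "vp (R f a g b i)" s] R vp_in_X b by auto
      moreover have "max 0 (d (vp (g i)) (vp (R f a g b i)) - s) \<le> 1 - s" using R(3)[of f] b by simp
      ultimately show ?thesis by (intro bexI[of _ z]) auto
    qed
    then obtain c where c: "\<And>i. i < k \<Longrightarrow> c i \<in> X \<and> d (vp (g i)) (c i) \<le> s \<and> d (c i) (vp (R f a g b i)) \<le> 1 - s"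
      by metis
    have "\<forall>i<k. d (c i) (vp (g i)) \<le> s \<and> d (c i) (vp (R f a g b i)) \<le> 1 - s"
      using c d_sym by metis
    then have "valid (f, a, g) y c"
      using star.hyps star.prems free c b by (auto intro!: exI[of _ b] exI[of _ s])
    moreover have "s \<le> d (vp a) y" using star b by simp
    ultimately show ?thesis using c star by (intro exI[of _ "(f, a, g)"] exI[of _ c]) fastforce
  qed
next
  case (step a b)
  have ab: "a \<in> V" "b \<in> V" using step arc_verts by auto
  have free: "\<forall>i<k. g i \<noteq> a" using step.prems by fastforce
  let ?g = "R f a g b"
  have R: "vp (g i) \<in> X" "vp (?g i) \<in> X" "d (vp (g i)) (vp (?g i)) \<le> 1" if "i < k" for i
    using R_adj[OF step.hyps(1) step.prems(1) free that] vp_in_X by blast+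
  have R': "moves k g ?g" "N (True, b, ?g) < N (f, a, g)"
    using R_less[OF step.hyps(1) step.prems(1) free] by auto
  have "d (vp b) y < d (vp (?g i)) y" if "i < k" for i
    using d_triangle[OF R(1,2)[OF that] \<open>y \<in> X\<close>] R(3)[OF that] step.prems(2)[OF that] step.hyps(2)
    by linarith
  from step.IH[of ?g True, OF _ this] R'(1) obtain \<sigma> c where
    \<sigma>: "valid \<sigma> y c" "\<And>i. i < k \<Longrightarrow> d (vp (?g i)) (c i) \<le> d (vp b) y"
      "N \<sigma> < N (True, b, ?g) \<or> \<sigma> = (True, b, ?g)"
    unfolding cop_moves_def by blast
  have "d (vp (g i)) (c i) \<le> d (vp a) y" if "i < k" for i
  proof -
    have "c i \<in> X" using \<sigma>(1) that by (cases \<sigma>) auto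
    then show ?thesis
      using d_triangle[OF R(1,2)[OF that], of "c i"] R(3)[OF that] \<sigma>(2)[OF that] step.hyps(2)
      by linarith
  qed
  moreover have "N \<sigma> < N (f, a, g)" using \<sigma>(3) R'(2) by auto
  ultimately show ?case using \<sigma>(1) by blast
qed

text \<open>The robber goes along his edge, on through \<open>b\<close>, or back through
  \<open>a\<close>. Passing \<open>b\<close> lowers \<open>N\<close>; in the other two cases the
  state may persist, and then the move is \<open>close\<close>.\<close>

lemma valid_step:
  assumes valid: "valid (f, a, g) r c" and r': "r' \<in> X" "d r r' \<le> t"
    and free: "\<And>i. i < k \<Longrightarrow> t < d (c i) r'"
  shows "\<exists>\<sigma> c'. valid \<sigma> r' c' \<and> (\<forall>i<k. d (c i) (c' i) \<le> t) \<and>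
    (N \<sigma> < N (f, a, g) \<or> \<sigma> = (f, a, g) \<and> close a r r' t)"
proof -
  have g: "a \<in> V" "g \<in> tuples V k" "\<forall>i<k. g i \<noteq> a" and cX: "\<And>i. i < k \<Longrightarrow> c i \<in> X"
    using valid by auto
  have gV: "g i \<in> V" if "i < k" for i using g that by (auto simp: tuples_iff)
  \<comment> \<open>Within the time \<open>s\<close> that the robber is allotted to reach
    \<open>b\<close>, the cops reach \<open>h\<close>; \<open>valid_from_vertex\<close> covers the
    rest. Its strict inequality comes from \<open>free\<close>, as a cop going through
    \<open>h\<close> would otherwise be within \<open>t\<close> of \<open>r'\<close>.\<close>
  have via: "\<exists>\<sigma> c'. valid \<sigma> r' c' \<and> (\<forall>i<k. d (c i) (c' i) \<le> t) \<and>
      (N \<sigma> < N (f', b, h) \<or> \<sigma> = (f', b, h) \<and> s + (1 - r' b) \<le> t)"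
    if "b \<in> V" "h \<in> tuples V k" "\<And>i. i < k \<Longrightarrow> d (c i) (vp (h i)) \<le> s" "s + d (vp b) r' \<le> t"
    for b h s f'
  proof -
    have hX: "vp (h i) \<in> X" if "i < k" for i
      using that \<open>h \<in> _\<close> vp_in_X by (auto simp: tuples_iff)
    have "d (vp b) r' < d (vp (h i)) r'" if "i < k" for i
      using d_triangle[OF cX hX r'(1)] free that \<open>s + _ \<le> t\<close> \<open>\<And>i. i < k \<Longrightarrow> d (c i) (vp (h i)) \<le> s\<close>
      by fastforce
    from valid_from_vertex[OF that(1) r'(1) that(2) this, of f'] obtain \<sigma> c' where
      \<sigma>: "valid \<sigma> r' c'" "\<forall>i<k. d (vp (h i)) (c' i) \<le> d (vp b) r'"
        "N \<sigma> < N (f', b, h) \<or> \<sigma> = (f', b, h) \<and> 1 - r' b \<le> d (vp b) r'" by blast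
    have "d (c i) (c' i) \<le> t" if "i < k" for i
    proof -
      have "c' i \<in> X" using \<sigma>(1) that by (cases \<sigma>) auto
      then show ?thesis
        using d_triangle[OF cX hX, of i i "c' i"] \<sigma>(2) that \<open>s + _ \<le> t\<close>
          \<open>\<And>i. i < k \<Longrightarrow> d (c i) (vp (h i)) \<le> s\<close>[OF that] by fastforce
    qed
    moreover have "N \<sigma> < N (f', b, h) \<or> \<sigma> = (f', b, h) \<and> s + (1 - r' b) \<le> t"
      using \<sigma>(3) that(4) by auto
    ultimately show ?thesis using \<sigma>(1) by blast
  qed
  from valid consider "r = vp a" "\<And>i. i < k \<Longrightarrow> c i = vp (g i)"
    | b s where "(a, b) \<in> E" "0 \<le> s" "s < 1" "r = pt a b s"
      "\<And>i. i < k \<Longrightarrow> d (c i) (vp (g i)) \<le> s" "\<And>i. i < k \<Longrightarrow> d (c i) (vp (R f a g b i)) \<le> 1 - s"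
    by auto
  then show ?thesis
  proof cases
    case 1
    have "d (c i) (vp (g i)) \<le> 0" if "i < k" for i using 1 that gV vp_in_X by simp
    moreover have "0 + d (vp a) r' \<le> t" using 1 r' by simp
    moreover have "close a r r' t" if "0 + (1 - r' a) \<le> t" using 1 that by (simp add: close_def)
    ultimately show ?thesis using via[OF g(1,2), where f' = f] by blast
  next
    case (2 b s)
    let ?g = "R f a g b"
    have b: "b \<in> V" using 2 arc_verts by auto
    have g': "?g \<in> tuples V k" "N (True, b, ?g) < N (f, a, g)"
      using R_less[OF 2(1) g(2,3)] by (auto simp: cop_moves_def)
    have R: "vp (?g i) \<in> X" if "i < k" for i
      using R_adj(2)[OF 2(1) g(2,3) that] by (rule vp_in_X)
    have via_b: ?thesis if "1 - s + d (vp b) r' \<le> t"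
    proof -
      from via[OF b g'(1) _ that, of True] 2(6) obtain \<sigma> c' where
        *: "valid \<sigma> r' c'" "\<forall>i<k. d (c i) (c' i) \<le> t"
        and "N \<sigma> < N (True, b, ?g) \<or> \<sigma> = (True, b, ?g) \<and> 1 - s + (1 - r' b) \<le> t" by blast
      then have "N \<sigma> < N (f, a, g)" using g'(2) by auto
      then show ?thesis using * by blast
    qed
    from \<open>(a, b) \<in> E\<close> \<open>0 \<le> s\<close> less_imp_le[OF \<open>s < 1\<close>] r'(1) show ?thesis
    proof (cases rule: dist_from_edge_cases)
      case edge: (1 s')
      show ?thesis
      \<comment> \<open>The far end is outside the open star of \<open>a\<close>, so arriving
        exactly there counts as passing through \<open>b\<close>.\<close>
      proof (cases "s' = 1")
        case True
        then have "d (vp b) r' = 0" using edge pt_1 2 b vp_in_X by simp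
        then show ?thesis using via_b edge True 2 r' by auto
      next
        case False
        then have s': "0 \<le> s'" "s' < 1" "\<bar>s - s'\<bar> \<le> t" using edge 2 r' by auto
        have "\<exists>z\<in>X. d (c i) z \<le> \<bar>s - s'\<bar> \<and> d z (vp (g i)) \<le> s' \<and> d z (vp (?g i)) \<le> 1 - s'"
          if ik: "i < k" for i
        \<comment> \<open>Each cop moves at most as far as the robber, towards his answer or back
          towards \<open>g i\<close>; the triangle inequality preserves the bound at the other
          end.\<close>
        proof (cases "s \<le> s'")
          case True
          then obtain z where z: "z \<in> X" "d (c i) z \<le> s' - s" "d z (vp (?g i)) \<le> max 0 (d (c i) (vp (?g i)) - (s' - s))"
            using between[OF cX[OF ik] R[OF ik], of "s' - s"] by auto
          moreover have "d z (vp (g i)) \<le> d (c i) z + d (c i) (vp (g i))"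
            using d_triangle[of z "c i" "vp (g i)"] z cX gV that vp_in_X d_sym[of z] by auto
          ultimately show ?thesis using 2(5,6)[OF that] s' True by (intro bexI[of _ z]) auto
        next
          case False
          then obtain z where z: "z \<in> X" "d (c i) z \<le> s - s'" "d z (vp (g i)) \<le> max 0 (d (c i) (vp (g i)) - (s - s'))"
            using between[OF cX[OF ik] vp_in_X[OF gV[OF ik]], of "s - s'"] by auto
          moreover have "d z (vp (?g i)) \<le> d (c i) z + d (c i) (vp (?g i))"
            using d_triangle[of z "c i" "vp (?g i)"] z cX R that vp_in_X d_sym[of z] by auto
          ultimately show ?thesis using 2(5,6)[OF that] s' False by (intro bexI[of _ z]) auto
        qed
        then obtain c' where c': "\<And>i. i < k \<Longrightarrow> c' i \<in> X \<and> d (c i) (c' i) \<le> \<bar>s - s'\<bar> \<and>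
          d (c' i) (vp (g i)) \<le> s' \<and> d (c' i) (vp (?g i)) \<le> 1 - s'" by metis
        have "valid (f, a, g) r' c'"
          using g c' s' 2 edge by (auto intro!: exI[of _ b] exI[of _ s'])
        moreover have "close a r r' t" unfolding close_def using 2 s' edge by blast
        moreover have "\<forall>i<k. d (c i) (c' i) \<le> t" using c' s' by force
        ultimately show ?thesis by blast
      qed
    next
      case 2
      then show ?thesis using via_b r' \<open>r = _\<close> by simp
    next
      case 3
      then have "s + d (vp a) r' \<le> t" using r' 2 by simp
      moreover have "close a r r' t" if "s + (1 - r' a) \<le> t" using 2 that by (simp add: close_def)
      ultimately show ?thesis using via[OF g(1,2) 2(5), where f' = f] by blast
    qed
  qed
qed

text \<open>By \<open>R_wait\<close> the answer of waiting cops is \<open>g\<close> itself, so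
  standing on \<open>g\<close> meets both distance bounds wherever the robber is on his edge. The
  edge is read from an end other than \<open>v\<close>, because \<open>valid\<close> keeps
  \<open>g\<close> off \<open>a\<close>.\<close>

lemma valid_start:
  assumes "r \<in> X" "v \<in> V" "\<And>i. i < k \<Longrightarrow> c i = vp v \<and> c i \<noteq> r"
  shows "\<exists>\<sigma>. valid \<sigma> r c"
proof -
  let ?g = "\<lambda>i\<in>{..<k}. v"
  have g: "?g \<in> tuples V k" using assms by (auto intro: restrict_in_tuples)
  from \<open>r \<in> X\<close> show ?thesis
  proof (cases rule: X_cases)
    case (vertex a)
    then have "valid (False, a, ?g) r c" using g assms vp_in_X by auto
    then show ?thesis by blast
  next
    case (edge a b s)
    obtain a' b' s' where e: "(a', b') \<in> E" "0 < s'" "s' < 1" "r = pt a' b' s'" "a' \<noteq> v"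
    proof (cases "a = v")
      case True
      then show thesis
        using that[of b a "1 - s"] edge arc_sym arc_neq pt_swap by fastforce
    qed (use edge that in blast)
    then have "valid (False, a', ?g) r c"
      using g assms vp_in_X arc_verts by (auto simp: R_wait intro!: exI[of _ b'] exI[of _ s'])
    then show ?thesis by blast
  qed
qed

section \<open>The extra cop in the star of a vertex\<close>

definition toward :: "('a \<Rightarrow> real) \<Rightarrow> ('a \<Rightarrow> real) \<Rightarrow> real \<Rightarrow> 'a \<Rightarrow> real" where
  "toward x y t = (SOME z. z \<in> X \<and> d x z \<le> t \<and> d z y \<le> max 0 (d x y - t))"

lemma toward:
  assumes "x \<in> X" "y \<in> X" "0 \<le> t"
  shows "toward x y t \<in> X" "d x (toward x y t) \<le> t" "d (toward x y t) y \<le> max 0 (d x y - t)"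
  using someI_ex[OF between[OF assms, unfolded Bex_def]] unfolding toward_def by blast+

text \<open>\<open>y + t \<le> s\<close> keeps the cop between the centre and the robber after a
  full step. With \<open>y = 0\<close> he stands at the centre and can enter any leg.\<close>

definition advance :: "'a \<Rightarrow> ('a \<Rightarrow> real) \<Rightarrow> ('a \<Rightarrow> real) \<Rightarrow> real \<Rightarrow> ('a \<Rightarrow> real) \<Rightarrow> bool" where
  "advance a x r t z \<longleftrightarrow> (\<exists>b y s. (a, b) \<in> E \<and> 0 \<le> y \<and> y + t \<le> s \<and> s < 1 \<and>
    x = pt a b y \<and> r = pt a b s \<and> z = pt a b (y + t))"

definition chase :: "'a \<Rightarrow> ('a \<Rightarrow> real) \<Rightarrow> ('a \<Rightarrow> real) \<Rightarrow> real \<Rightarrow> 'a \<Rightarrow> real" where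
  "chase a x r t = (if \<exists>z. advance a x r t z then SOME z. advance a x r t z else toward x (vp a) t)"

lemma chase_advance: "advance a x r t z \<Longrightarrow> advance a x r t (chase a x r t)"
  unfolding chase_def by (simp add: exI[of "advance a x r t"] someI[of "advance a x r t"])

lemma chase_move:
  assumes "x \<in> X" "a \<in> V" "0 \<le> t"
  shows "chase a x r t \<in> X \<and> d x (chase a x r t) \<le> t"
proof (cases "\<exists>z. advance a x r t z")
  case True
  then obtain z where "advance a x r t z" ..
  from chase_advance[OF this] obtain b y s where "(a, b) \<in> E" "0 \<le> y" "y + t \<le> s" "s < 1"
    "x = pt a b y" "chase a x r t = pt a b (y + t)" unfolding advance_def by blast
  then show ?thesis using d_edge_le[of a b y "y + t"] pt_in_X assms by auto
next
  case False
  then show ?thesis using toward assms vp_in_X by (simp add: chase_def)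
qed

definition behind :: "'a \<Rightarrow> ('a \<Rightarrow> real) \<Rightarrow> ('a \<Rightarrow> real) \<Rightarrow> bool" where
  "behind a x r \<longleftrightarrow> (\<exists>b y s. (a, b) \<in> E \<and> 0 \<le> y \<and> y \<le> s \<and> s < 1 \<and> x = pt a b y \<and> r = pt a b s)"

lemma advance_behind:
  assumes "advance a x r t z" "0 \<le> t"
  shows "behind a z r \<and> z a = x a - t"
proof -
  from assms(1) obtain b y s where *: "(a, b) \<in> E" "0 \<le> y" "y + t \<le> s" "s < 1"
    "x = pt a b y" "r = pt a b s" "z = pt a b (y + t)" unfolding advance_def by blast
  then have "behind a z r"
    unfolding behind_def using assms(2) by (intro exI[of _ b] exI[of _ "y + t"] exI[of _ s]) auto
  then show ?thesis using * by simp
qed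

text \<open>A robber who crosses the centre covers more on the way there than the cop's distance
  \<open>y\<close>, so the cop could reach \<open>r'\<close> within \<open>t\<close>, against
  \<open>far\<close>. Getting past the cop on the leg is impossible for the same reason.\<close>

lemma behind_step:
  assumes behind: "behind a x r" and "x \<noteq> r" and star: "in_star a r'" and V: "a \<in> V"
    and "close a r r' t" and far: "t < d x r'"
  shows "\<exists>z. advance a x r' t z"
proof -
  from behind obtain b y s where b: "(a, b) \<in> E" "0 \<le> y" "y \<le> s" "s < 1" "x = pt a b y" "r = pt a b s"
    unfolding behind_def by blast
  then have ys: "y < s" using \<open>x \<noteq> r\<close> by (cases "y = s") auto
  have X: "x \<in> X" "r' \<in> X" "vp a \<in> X"
    using b star pt_in_X V vp_in_X by (auto simp: in_star_def)
  from \<open>close a r r' t\<close> show ?thesis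
    unfolding close_def
  proof (elim disjE exE conjE)
    assume "(1 - r a) + (1 - r' a) \<le> t"
    moreover have "d x (vp a) \<le> y" using d_edge_le[of a b y 0] b by simp
    moreover have "d (vp a) r' \<le> 1 - r' a" using star V by (rule in_star_dist)
    ultimately have False using d_triangle[OF X(1,3,2)] far ys b(6) by simp
    then show ?thesis ..
  next
    fix b1 s1 s' assume *: "(a, b1) \<in> E" "0 \<le> s1" "s1 < 1" "0 \<le> s'" "s' < 1"
      "r = pt a b1 s1" "r' = pt a b1 s'" "\<bar>s1 - s'\<bar> \<le> t"
    have "b = b1 \<and> s = s1" using pt_inj[of a b s b1 s1] b * ys arc_neq by auto
    then have r': "r' = pt a b s'" "\<bar>s - s'\<bar> \<le> t" using * by auto
    have "t < \<bar>y - s'\<bar>" using d_edge_le[of a b y s'] b * r' far by simp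
    then have "y + t \<le> s'" using r' ys by linarith
    then show ?thesis unfolding advance_def using b * r' by blast
  qed
qed

text \<open>Always heading for the centre would bring the cop there, and then he can enter the
  robber's leg. Once behind, he stays behind, and his coordinate at \<open>a\<close> loses the full
  \<open>\<tau>\<close> in every step although it is never negative.\<close>

lemma chase_catches:
  assumes \<tau>: "\<tau> \<in> agilities" and V: "a \<in> V"
    and star: "\<And>n. m \<le> n \<Longrightarrow> in_star a (r n)"
    and close: "\<And>n. m \<le> n \<Longrightarrow> close a (r n) (r (Suc n)) (\<tau> (Suc n))"
    and x: "\<And>n. x n \<in> X" "\<And>n. m \<le> n \<Longrightarrow> x (Suc n) = chase a (x n) (r (Suc n)) (\<tau> (Suc n))"
    and far: "\<And>n. m \<le> n \<Longrightarrow> \<tau> (Suc n) < d (x n) (r (Suc n))" and neq: "\<And>n. x n \<noteq> r n"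
  shows False
proof -
  have t: "0 \<le> \<tau> (Suc n)" for n using \<tau> by (auto simp: agilities_def)
  have adv: "behind a (x (Suc n)) (r (Suc n)) \<and> x (Suc n) a = x n a - \<tau> (Suc n)"
    if "\<exists>z. advance a (x n) (r (Suc n)) (\<tau> (Suc n)) z" "m \<le> n" for n
    using that chase_advance advance_behind[OF _ t] x(2)[OF that(2)] by metis
  have behind: "\<exists>z. advance a (x n) (r (Suc n)) (\<tau> (Suc n)) z"
    if "behind a (x n) (r n)" "m \<le> n" for n
    using behind_step[OF that(1) neq _ V close far] that star by simp
  have "\<exists>n\<ge>m. \<exists>z. advance a (x n) (r (Suc n)) (\<tau> (Suc n)) z"
  proof (rule ccontr)
    assume no: "\<not> ?thesis"
    have "d (x (Suc n)) (vp a) \<le> max 0 (d (x n) (vp a) - \<tau> (Suc n))" if "m \<le> n" for n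
      using no that x toward(3)[OF x(1) vp_in_X[OF V] t] by (simp add: chase_def)
    from approach_arrives[OF \<tau> this] obtain n where n: "m \<le> n" "d (x n) (vp a) \<le> 0" by auto
    then have xn: "x n = vp a" using d_eq_0 x(1) V vp_in_X by auto
    have "r (Suc n) \<noteq> vp a" using far[OF n(1)] t[of n] xn V vp_in_X by auto
    then obtain b s where b: "(a, b) \<in> E" "0 < s" "s < 1" "r (Suc n) = pt a b s"
      using in_star_leg star n by (metis le_SucI)
    have "\<tau> (Suc n) \<le> s" using far[OF n(1)] d_edge_le[of a b 0 s] b xn by simp
    then have "advance a (x n) (r (Suc n)) (\<tau> (Suc n)) (pt a b (0 + \<tau> (Suc n)))"
      unfolding advance_def using b xn pt_simps(4) by (metis add_0 order_refl)
    then show False using no n by blast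
  qed
  then obtain n0 where n0: "m \<le> n0" "behind a (x n0) (r n0)" using adv le_SucI by blast
  have on: "behind a (x n) (r n)" if "n0 \<le> n" for n
    using that by (induction rule: dec_induct) (use n0 behind adv in auto)
  show False
    using \<tau>
  proof (rule drift_unbounded)
    show "- x n a + \<tau> (Suc n) \<le> - x (Suc n) a" if "n0 \<le> n" for n
      using adv[OF behind[OF on[OF that]]] that n0 by simp
    show "- x n a \<le> 0" if "n0 \<le> n" for n
      using on[OF that] unfolding behind_def by auto
  qed
qed

section \<open>The joint positional strategy\<close>

definition home :: 'a where "home = (SOME v. v \<in> V)"

lemma home: "home \<in> V"
  using verts_nonempty some_in_eq unfolding home_def by blast

text \<open>
  A cop strategy sees neither the past nor the robber's previous position, so the cops cannot remember
  the state they are in; they move to the position that admits the least state.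
\<close>

definition admits where
  "admits r c t = (\<lambda>(c', \<sigma>). c' \<in> tuples X k \<and> (\<forall>i<k. d (c i) (c' i) \<le> t) \<and> valid \<sigma> r c')"

definition best where
  "best r c t = arg_min (N \<circ> snd) (admits r c t)"

text \<open>The cop with index \<open>k\<close> is the extra one; his target is the vertex of the
  best state. The robber chose the cops' start, so without an admissible state the others gather at
  \<open>home\<close>, the situation of \<open>valid_start\<close>.\<close>

definition cops :: "('a \<Rightarrow> real) \<Rightarrow> (nat \<Rightarrow> 'a \<Rightarrow> real) \<Rightarrow> real \<Rightarrow> nat \<Rightarrow> 'a \<Rightarrow> real" where
  "cops r c t = (\<lambda>i\<in>{..<Suc k}.
    if \<exists>j<Suc k. d (c j) r \<le> t then if d (c i) r \<le> t then r else c i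
    else if \<exists>p. admits r c t p then
      if i < k then fst (best r c t) i else chase (fst (snd (snd (best r c t)))) (c i) r t
    else if i < k then toward (c i) (vp home) t else c i)"

lemma best:
  assumes "admits r c t p"
  shows "admits r c t (best r c t)" "N (snd (best r c t)) \<le> N (snd p)"
proof -
  show "admits r c t (best r c t)" unfolding best_def using assms by (rule arg_min_natI)
  have "(N \<circ> snd) (best r c t) \<le> (N \<circ> snd) p"
    unfolding best_def using assms by (rule arg_min_nat_le)
  then show "N (snd (best r c t)) \<le> N (snd p)" by simp
qed

lemma cops_simps:
  assumes "i < Suc k"
  shows "\<exists>j<Suc k. d (c j) r \<le> t \<Longrightarrow> cops r c t i = (if d (c i) r \<le> t then r else c i)"
    and "\<not> (\<exists>j<Suc k. d (c j) r \<le> t) \<Longrightarrow> admits r c t p \<Longrightarrow> cops r c t i =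
      (if i < k then fst (best r c t) i else chase (fst (snd (snd (best r c t)))) (c i) r t)"
    and "\<not> (\<exists>j<Suc k. d (c j) r \<le> t) \<Longrightarrow> \<not> (\<exists>p. admits r c t p) \<Longrightarrow> cops r c t i =
      (if i < k then toward (c i) (vp home) t else c i)"
proof -
  note [simp del] = split_paired_Ex
  show "\<exists>j<Suc k. d (c j) r \<le> t \<Longrightarrow> cops r c t i = (if d (c i) r \<le> t then r else c i)"
    using assms by (simp add: cops_def)
  show "cops r c t i = (if i < k then fst (best r c t) i else chase (fst (snd (snd (best r c t)))) (c i) r t)"
    if "\<not> (\<exists>j<Suc k. d (c j) r \<le> t)" "admits r c t p"
  proof -
    have "\<exists>p. admits r c t p" using that(2) ..
    with that(1) show ?thesis using assms unfolding cops_def by (simp only: restrict_apply lessThan_iff if_True if_False)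
  qed
  show "cops r c t i = (if i < k then toward (c i) (vp home) t else c i)"
    if "\<not> (\<exists>j<Suc k. d (c j) r \<le> t)" "\<not> (\<exists>p. admits r c t p)"
    using that assms unfolding cops_def by (simp only: restrict_apply lessThan_iff if_True if_False)
qed

lemma cops_strategy: "cops \<in> cop_strategies X d (Suc k)"
proof -
  have "cops r c t i \<in> X \<and> d (c i) (cops r c t i) \<le> t"
    if r: "r \<in> X" and c: "c \<in> tuples X (Suc k)" and t: "0 \<le> t" and i: "i < Suc k" for r c t i
  proof -
    have ci: "c i \<in> X" using c i by (auto simp: tuples_iff)
    consider "\<exists>j<Suc k. d (c j) r \<le> t"
      | p where "\<not> (\<exists>j<Suc k. d (c j) r \<le> t)" "admits r c t p"
      | "\<not> (\<exists>j<Suc k. d (c j) r \<le> t)" "\<not> (\<exists>p. admits r c t p)" by blast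
    then show ?thesis
    proof cases
      case 1
      then show ?thesis using r ci t i by (simp add: cops_simps(1))
    next
      case (2 p)
      obtain c' f a g where b: "best r c t = (c', f, a, g)" by (cases "best r c t") auto
      from best(1)[OF 2(2)] have "c' \<in> tuples X k" "\<forall>i<k. d (c i) (c' i) \<le> t" "a \<in> V"
        unfolding b admits_def by auto
      then show ?thesis
        using i ci t chase_move[of "c i" a t r] b unfolding cops_simps(2)[OF i 2]
        by (auto simp: tuples_iff)
    next
      case 3
      then show ?thesis using toward ci t home vp_in_X unfolding cops_simps(3)[OF i 3] by auto
    qed
  qed
  then show ?thesis
    by (simp add: cop_strategies_def tuples_iff) (simp add: cops_def)
qed

lemma cops_catch_robber: "cops_catch X d (Suc k)"
  unfolding cops_catch_def
proof (intro ballI bexI allI impI; (elim conjE)?)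
  show "cops \<in> cop_strategies X d (Suc k)" by (rule cops_strategy)
  fix \<tau> and r :: "nat \<Rightarrow> 'a \<Rightarrow> real" and c
  assume \<tau>: "\<tau> \<in> agilities" and rX: "\<forall>n. r n \<in> X" and c0: "c 0 \<in> tuples X (Suc k)"
    and r_step: "\<forall>n. d (r n) (r (Suc n)) \<le> \<tau> (Suc n)"
    and c_step: "\<forall>n. c (Suc n) = cops (r (Suc n)) (c n) (\<tau> (Suc n))"
  have t: "0 \<le> \<tau> (Suc n)" for n using \<tau> by (auto simp: agilities_def)
  have c: "c n \<in> tuples X (Suc k)" for n
    using cops_strategy c0 c_step rX t by (induction n) (auto simp: cop_strategies_def)
  then have cX: "c n i \<in> X" if "i < Suc k" for n i using that by (auto simp: tuples_iff)
  show "\<exists>n. \<exists>i<Suc k. c n i = r n"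
  proof (rule ccontr)
    assume "\<not> ?thesis"
    then have neq: "c n i \<noteq> r n" if "i < Suc k" for n i using that by blast
    have far: "\<tau> (Suc n) < d (c n i) (r (Suc n))" if "i < Suc k" for n i
    proof (rule ccontr)
      assume "\<not> ?thesis"
      then have "cops (r (Suc n)) (c n) (\<tau> (Suc n)) i = r (Suc n)"
        using that by (subst cops_simps(1)[OF that]) (auto simp: not_less)
      then show False using neq[OF that, of "Suc n"] c_step by simp
    qed
    then have nocatch: "\<not> (\<exists>j<Suc k. d (c n j) (r (Suc n)) \<le> \<tau> (Suc n))" for n
      by (auto simp: not_le)
    let ?best = "\<lambda>n. best (r (Suc n)) (c n) (\<tau> (Suc n))"
    let ?admits = "\<lambda>n. admits (r (Suc n)) (c n) (\<tau> (Suc n))"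
    have c_best: "valid (snd (?best n)) (r (Suc n)) (c (Suc n))"
      "c (Suc n) k = chase (fst (snd (snd (?best n)))) (c n k) (r (Suc n)) (\<tau> (Suc n))"
      if "?admits n p" for n p
    proof -
      obtain c' f a g where b: "?best n = (c', f, a, g)" by (cases "?best n") auto
      from best(1)[OF that] have "valid (f, a, g) (r (Suc n)) c'" unfolding b admits_def by auto
      moreover have "c (Suc n) i = c' i" if "i < k" for i
        using cops_simps(2)[OF less_SucI[OF that] nocatch \<open>?admits n p\<close>] that c_step b by simp
      ultimately show "valid (snd (?best n)) (r (Suc n)) (c (Suc n))" unfolding b by auto
      show "c (Suc n) k = chase (fst (snd (snd (?best n)))) (c n k) (r (Suc n)) (\<tau> (Suc n))"
        using cops_simps(2)[OF lessI nocatch that] c_step by simp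
    qed
    \<comment> \<open>Without any valid state the first \<open>k\<close> cops would all arrive at
      \<open>home\<close>, and \<open>valid_start\<close> would supply one.\<close>
    have "\<exists>n \<sigma>. valid \<sigma> (r n) (c n)"
    proof (rule ccontr)
      assume no: "\<not> ?thesis"
      then have "\<not> (\<exists>p. ?admits n p)" for n using c_best(1) by blast
      then have cs: "c (Suc n) i = toward (c n i) (vp home) (\<tau> (Suc n))" if "i < k" for n i
        using cops_simps(3)[OF less_SucI[OF that] nocatch, of n] c_step that by simp
      have "\<exists>m\<ge>0. \<forall>n\<ge>m. d (c n i) (vp home) \<le> 0" if "i < k" for i
        using toward(3)[OF cX vp_in_X[OF home] t] cs that by (intro approach_arrives[OF \<tau>]) simp
      then obtain m where m: "\<And>i n. i < k \<Longrightarrow> m i \<le> n \<Longrightarrow> d (c n i) (vp home) \<le> 0" by metis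
      define M where "M = (\<Sum>i<k. m i)"
      have "c M i = vp home" if "i < k" for i
      proof -
        have "m i \<le> M" unfolding M_def using that by (intro member_le_sum) auto
        then show ?thesis using m[OF that] d_eq_0 cX[of i M] that home vp_in_X by simp
      qed
      then have "\<exists>\<sigma>. valid \<sigma> (r M) (c M)" using rX home neq by (intro valid_start[of _ home]) auto
      then show False using no by blast
    qed
    then obtain n0 \<sigma>0 where \<sigma>0: "valid \<sigma>0 (r n0) (c n0)" by blast
    have next_state: "\<exists>p. ?admits n p \<and> (N (snd (?best n)) < N \<sigma> \<or>
        snd (?best n) = \<sigma> \<and> close (fst (snd \<sigma>)) (r n) (r (Suc n)) (\<tau> (Suc n)))"
      if v: "valid \<sigma> (r n) (c n)" for n \<sigma>
    proof -
      obtain f a g where \<sigma>: "\<sigma> = (f, a, g)" by (cases \<sigma>) auto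
      obtain \<sigma>' c' where *: "valid \<sigma>' (r (Suc n)) c'" "\<forall>i<k. d (c n i) (c' i) \<le> \<tau> (Suc n)"
        "N \<sigma>' < N \<sigma> \<or> \<sigma>' = \<sigma> \<and> close a (r n) (r (Suc n)) (\<tau> (Suc n))"
        using valid_step[OF v[unfolded \<sigma>] rX[rule_format] r_step[rule_format] far[OF less_SucI]]
        unfolding \<sigma> by blast
      have "\<forall>i<k. c' i \<in> X" using *(1) by (cases \<sigma>') auto
      then have adm: "?admits n (restrict c' {..<k}, \<sigma>')"
        using * by (cases \<sigma>') (auto simp: admits_def intro!: restrict_in_tuples)
      have le: "N (snd (?best n)) \<le> N \<sigma>'" using best(2)[OF adm] by simp
      \<comment> \<open>The least state need not be the \<open>\<sigma>'\<close> of
        \<open>valid_step\<close>. If the potential has not dropped, injectivity forces it to be the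
        old state, so \<open>close\<close> refers to the same centre.\<close>
      have "snd (?best n) = \<sigma>" if "N (snd (?best n)) = N \<sigma>"
      proof (rule inj_onD[OF N_inj that])
        show "snd (?best n) \<in> UNIV \<times> V \<times> tuples V k"
          using c_best(1)[OF adm] by (cases "snd (?best n)") auto
        show "\<sigma> \<in> UNIV \<times> V \<times> tuples V k" using v \<sigma> by auto
      qed
      then show ?thesis using adm le *(3) \<sigma> by (intro exI[of _ "(restrict c' {..<k}, \<sigma>')"]) auto
    qed
    \<comment> \<open>Chosen in step \<open>Suc n\<close>, the state \<open>S n\<close> belongs to
      the positions at time \<open>Suc n\<close>; hence the shifted indices below.\<close>
    define S where "S n = snd (?best n)" for n
    have S: "valid (S n) (r (Suc n)) (c (Suc n))" if "n0 \<le> n" for n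
      using that
    proof (induction rule: dec_induct)
      case base
      from next_state[OF \<sigma>0] obtain p where "?admits n0 p" by blast
      then show ?case unfolding S_def by (rule c_best(1))
    next
      case (step n)
      from next_state[OF step.IH] obtain p where "?admits (Suc n) p" by blast
      then show ?case unfolding S_def by (rule c_best(1))
    qed
    have S_step: "N (S (Suc n)) < N (S n) \<or> S (Suc n) = S n \<and>
        close (fst (snd (S n))) (r (Suc n)) (r (Suc (Suc n))) (\<tau> (Suc (Suc n)))" if "n0 \<le> n" for n
    proof -
      from next_state[OF S[OF that]] obtain p where "N (snd (?best (Suc n))) < N (S n) \<or>
        snd (?best (Suc n)) = S n \<and>
        close (fst (snd (S n))) (r (Suc n)) (r (Suc (Suc n))) (\<tau> (Suc (Suc n)))" by (elim exE conjE)
      then show ?thesis unfolding S_def[of "Suc n"] .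
    qed
    have S_chase: "c (Suc (Suc n)) k = chase (fst (snd (S (Suc n)))) (c (Suc n) k) (r (Suc (Suc n))) (\<tau> (Suc (Suc n)))"
      if "n0 \<le> n" for n
    proof -
      from next_state[OF S[OF that]] obtain p where "?admits (Suc n) p" by blast
      then show ?thesis unfolding S_def by (rule c_best(2))
    qed
    \<comment> \<open>After a time of least potential no decrease is left, so the state is constant
      and the robber is confined to one star.\<close>
    obtain m where m: "n0 \<le> m" "\<And>n. n0 \<le> n \<Longrightarrow> N (S m) \<le> N (S n)"
      using ex_has_least_nat[of "\<lambda>n. n0 \<le> n" n0 "\<lambda>n. N (S n)"] le_refl by metis
    have const: "S n = S m" if "m \<le> n" for n
      using that
    proof (induction rule: dec_induct)
      case (step n)
      then have "n0 \<le> n" "N (S n) \<le> N (S (Suc n))" using m(1) m(2)[of "Suc n"] by auto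
      then show ?case using S_step[of n] step.IH by auto
    qed simp
    obtain f a g where Sm: "S m = (f, a, g)" by (cases "S m") auto
    have "valid (f, a, g) (r (Suc n)) (c (Suc n))" if "m \<le> n" for n
      using S[OF order_trans[OF m(1) that]] unfolding const[OF that] Sm .
    note star_Suc = valid_in_star[OF this]
    have aV: "a \<in> V" using star_Suc[of m] by blast
    have star: "in_star a (r n)" if "Suc m \<le> n" for n
      using star_Suc[of "n - 1"] that by (cases n) auto
    show False
    proof (rule chase_catches[OF \<tau> aV star, where x = "\<lambda>n. c n k"])
      fix n assume "Suc m \<le> n"
      then obtain l where l: "n = Suc l" "m \<le> l" by (cases n) auto
      then have Sl: "S l = (f, a, g)" "S (Suc l) = (f, a, g)" "n0 \<le> l"
        using const[of l] const[of "Suc l"] Sm m(1) by auto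
      then show "close a (r n) (r (Suc n)) (\<tau> (Suc n))"
        using S_step[OF Sl(3)] l by auto
      show "c (Suc n) k = chase a (c n k) (r (Suc n)) (\<tau> (Suc n))"
        using S_chase[OF Sl(3)] l Sl by simp
    qed (use cX far neq in blast)+
  qed
qed

end

section \<open>The chain of inequalities\<close>

lemma (in connected_graph) cops_catch_Suc:
  assumes "graph_cops_win G k"
  shows "cops_catch X d (Suc k)"
proof (rule potential_exists[OF graph_cops_winD[OF assms]])
  fix N :: "bool \<times> 'a \<times> (nat \<Rightarrow> 'a) \<Rightarrow> nat" and R
  assume "inj_on N (UNIV \<times> V \<times> tuples V k)"
    and "\<And>f a g b. (a, b) \<in> E \<Longrightarrow> g \<in> tuples V k \<Longrightarrow> \<forall>i<k. g i \<noteq> a \<Longrightarrow>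
      moves k g (R f a g b) \<and> N (True, b, R f a g b) < N (f, a, g)"
    and "\<And>a g b. R False a g b = g"
  then interpret pursuit G k N R by unfold_locales
  show ?thesis by (rule cops_catch_robber)
qed

lemma (in connected_graph) cop_number_bounds:
  "graph_cop_number G \<le> cop_number X d \<and> cop_number X d \<le> strong_cop_number X d \<and>
    strong_cop_number X d \<le> graph_cop_number G + 1"
proof (intro conjI)
  have "{enat k | k. k \<ge> 1 \<and> val_C X d k = 0} \<subseteq> {enat k | k. graph_cops_win G k}"
    using graph_cops_win_if_val_0 by blast
  then show "graph_cop_number G \<le> cop_number X d"
    unfolding graph_cop_number_def cop_number_def by (rule Inf_superset_mono)
  have "{enat k | k. k \<ge> 1 \<and> cops_catch X d k} \<subseteq> {enat k | k. k \<ge> 1 \<and> val_C X d k = 0}"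
    using val_0_if_cops_catch by blast
  then show "cop_number X d \<le> strong_cop_number X d"
    unfolding strong_cop_number_def cop_number_def by (rule Inf_superset_mono)
  let ?A = "{enat k | k. graph_cops_win G k}"
  show "strong_cop_number X d \<le> graph_cop_number G + 1"
  proof (cases "?A = {}")
    case True
    then show ?thesis unfolding graph_cop_number_def by (simp add: Inf_enat_def)
  next
    case False
    then obtain l where "l \<in> ?A" by blast
    then have "graph_cop_number G \<in> ?A"
      unfolding graph_cop_number_def by (rule wellorder_InfI)
    then obtain k where k: "graph_cop_number G = enat k" "graph_cops_win G k" by blast
    then have "enat (Suc k) \<in> {enat k | k. k \<ge> 1 \<and> cops_catch X d k}"
      using cops_catch_Suc[OF k(2)] by (intro CollectI exI[of _ "Suc k"] conjI) simp_all
    then have "strong_cop_number X d \<le> enat (Suc k)"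
      unfolding strong_cop_number_def by (rule Inf_lower)
    then show ?thesis by (simp add: k(1) one_enat_def)
  qed
qed

text \<open>\<open>connected\<close> means that the symmetrisation is strongly connected. Since
  \<open>G\<close> is symmetric, symmetrising adds no arcs, and reachability is the closure of
  \<open>parcs G\<close>.\<close>

lemma connected_graphI:
  assumes "pair_graph G" "Digraph_Component.connected (with_proj G)"
  shows "connected_graph G"
proof -
  interpret pair_graph G by fact
  have sc: "strongly_connected (mk_symmetric G)" using assms(2) by (simp add: connected_def)
  have sym: "(u, v) \<in> parcs G \<Longrightarrow> (v, u) \<in> parcs G" for u v by (rule arcs_symmetric)
  have arcs: "parcs (mk_symmetric G) = parcs G"
    using sym by (auto simp: parcs_mk_symmetric)
  show ?thesis
  proof
    show "finite (pverts G)" by (rule pair_finite_verts)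
    show "pverts G \<noteq> {}" using sc by (simp add: strongly_connected_def)
    show "u \<in> pverts G \<and> v \<in> pverts G" if "(u, v) \<in> parcs G" for u v
      using that wellformed' by blast
    show "(v, u) \<in> parcs G" if "(u, v) \<in> parcs G" for u v using sym that .
    show "u \<noteq> v" if "(u, v) \<in> parcs G" for u v using that no_loops' by blast
    show "(u, v) \<in> (parcs G)\<^sup>*" if "u \<in> pverts G" "v \<in> pverts G" for u v
    proof -
      have "reachable (mk_symmetric G) u v" using sc that by (simp add: strongly_connected_def)
      from reachable_rtranclI[OF this] show ?thesis by (simp add: arcs)
    qed
  qed
qed

theorem theorem8:
  fixes G :: "'a pair_pre_digraph"
  assumes "pair_graph G" and "Digraph_Component.connected (with_proj G)"
  shows "graph_cop_number G \<le> cop_number (metric_graph G) (metric_graph_dist G) \<and>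
    cop_number (metric_graph G) (metric_graph_dist G)
      \<le> strong_cop_number (metric_graph G) (metric_graph_dist G) \<and>
    strong_cop_number (metric_graph G) (metric_graph_dist G) \<le> graph_cop_number G + 1"
  using connected_graph.cop_number_bounds[OF connected_graphI[OF assms]] .

end
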